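(* Let $H$ be an ordered graph that is not a partial matching. Then there is a constant $c$ such that if $p>cn^{-1/m_2(H)}$, then the probability that the random graph $G(n,p)$, with vertex set $[n]$ ordered naturally, is an ordered Ramsey graph of $H$ tends to $1$ as $n\to\infty$.
   Context: An ordered graph is a finite simple graph together with a linear order of its vertex set. A copy of an ordered graph $H$ in $F$ is a subgraph of $F$ (with inherited order) isomorphic to $H$ via an order-preserving bijection. $F$ is an ordered Ramsey graph of $H$ if every red/blue coloring of the edges of $F$ contains a monochromatic copy of $H$. A partial matching is a graph containing no copy of the path $P_3$ on three vertices. The $2$-density of a graph $G$ is $m_2(G)=\max\{(|E(G')|-1)/(|V(G')|-2) : G'\subseteq G,\ |V(G')|\ge 3,\ |E(G')|\ge 1\}$. $G(n,p)$ is the binomial random graph on $[n]$ where each pair is an edge independently with probability $p$. *)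

theory Defs
  imports "HOL-Probability.Probability"
begin

record 'a graph =
  verts :: "'a set"
  edges :: "'a set set"

text \<open>The field \<open>vorder\<close> is the reflexive order relation on the vertices.\<close>

record 'a ograph = "'a graph" +
  vorder :: "'a rel"

definition simple_graph :: "('a, 'b) graph_scheme \<Rightarrow> bool" where
  "simple_graph G \<longleftrightarrow>
     finite (verts G) \<and> (\<forall>e \<in> edges G. e \<subseteq> verts G \<and> card e = 2)"

definition subgraph :: "('a, 'b) graph_scheme \<Rightarrow> ('a, 'c) graph_scheme \<Rightarrow> bool" where
  "subgraph G' G \<longleftrightarrow> simple_graph G' \<and> verts G' \<subseteq> verts G \<and> edges G' \<subseteq> edges G"

definition graph_iso ::
  "('a \<Rightarrow> 'b) \<Rightarrow> ('a, 'c) graph_scheme \<Rightarrow> ('b, 'd) graph_scheme \<Rightarrow> bool" where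
  "graph_iso f G H \<longleftrightarrow> bij_betw f (verts G) (verts H) \<and> edges H = (\<lambda>e. f ` e) ` edges G"

definition ordered_graph :: "'a ograph \<Rightarrow> bool" where
  "ordered_graph G \<longleftrightarrow> simple_graph G \<and> linear_order_on (verts G) (vorder G)"

definition ordered_subgraph :: "'a ograph \<Rightarrow> 'a ograph \<Rightarrow> bool" where
  "ordered_subgraph G' G \<longleftrightarrow> subgraph G' G \<and> vorder G' = Restr (vorder G) (verts G')"

definition ordered_graph_iso :: "('a \<Rightarrow> 'b) \<Rightarrow> 'a ograph \<Rightarrow> 'b ograph \<Rightarrow> bool" where
  "ordered_graph_iso f G H \<longleftrightarrow>
     graph_iso f G H \<and>
     (\<forall>x \<in> verts G. \<forall>y \<in> verts G. (x, y) \<in> vorder G \<longleftrightarrow> (f x, f y) \<in> vorder H)"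

definition ordered_copy :: "'a ograph \<Rightarrow> 'b ograph \<Rightarrow> 'a ograph \<Rightarrow> bool" where
  "ordered_copy H' H F \<longleftrightarrow> ordered_subgraph H' F \<and> (\<exists>f. ordered_graph_iso f H' H)"

datatype colour = Red | Blue

text \<open>A colouring is a total function on vertex sets; its values off the edges of \<open>F\<close> are
  irrelevant.\<close>

definition ordered_ramsey_graph :: "'a ograph \<Rightarrow> 'b ograph \<Rightarrow> bool" where
  "ordered_ramsey_graph F H \<longleftrightarrow>
     (\<forall>col :: 'a set \<Rightarrow> colour.
        \<exists>H' k. ordered_copy H' H F \<and> (\<forall>e \<in> edges H'. col e = k))"

definition P3 :: "nat graph" where
  "P3 = \<lparr>verts = {0, 1, 2}, edges = {{0, 1}, {1, 2}}\<rparr>"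

definition partial_matching :: "('a, 'b) graph_scheme \<Rightarrow> bool" where
  "partial_matching G \<longleftrightarrow> \<not> (\<exists>(P :: 'a graph) f. subgraph P G \<and> graph_iso f P P3)"

text \<open>For a finite graph the set below is finite; it is nonempty exactly when the graph has an
  edge and at least three vertices, and otherwise the value is unspecified.\<close>

definition two_density :: "('a, 'b) graph_scheme \<Rightarrow> real" where
  "two_density G =
     Max {(real (card (edges G')) - 1) / (real (card (verts G')) - 2) | G' :: 'a graph.
            subgraph G' G \<and> card (verts G') \<ge> 3 \<and> card (edges G') \<ge> 1}"

definition vertex_pairs :: "nat \<Rightarrow> nat set set" where
  "vertex_pairs n = {e. e \<subseteq> {1..n} \<and> card e = 2}"

text \<open>The random graph \<open>G(n,p)\<close>: one independent Bernoulli trial for each pair.\<close>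

definition random_graph :: "nat \<Rightarrow> real \<Rightarrow> nat graph pmf" where
  "random_graph n p =
     map_pmf (\<lambda>X. \<lparr>verts = {1..n}, edges = {e \<in> vertex_pairs n. X e}\<rparr>)
       (Pi_pmf (vertex_pairs n) False (\<lambda>_. bernoulli_pmf p))"

definition naturally_ordered :: "nat graph \<Rightarrow> nat ograph" where
  "naturally_ordered G =
     \<lparr>verts = verts G, edges = edges G,
      vorder = {(x, y). x \<in> verts G \<and> y \<in> verts G \<and> x \<le> y}\<rparr>"

end

theory Submission
  imports Defs "HOL-Library.Ramsey" "HOL-Real_Asymp.Real_Asymp"
begin

text \<open>The argument is the container proof of the random Ramsey theorem (Nenadov and Steger). In the
  hypergraph whose vertices are the pairs of \<open>[n]\<close> and whose edges are the edge sets of the copies of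
  \<open>H\<close> in the complete ordered graph, both colour classes of a colouring without monochromatic copy of
  \<open>H\<close> are independent. Hence each of them contains a fingerprint of \<open>O(n\<^sup>2 n\<^bsup>-1/m\<^sub>2(H)\<^esup>)\<close> pairs which
  determines a container of the class spanning few copies of \<open>H\<close>. By Ramsey's theorem and averaging,
  a positive proportion of all pairs lies outside the two containers, and the random graph has to
  avoid all of them. A union bound over the fingerprints finishes the proof.

  The containers are obtained without an algorithm: among the subsets \<open>T\<close> of an independent set one
  takes a maximiser of \<open>e(T) - \<lambda>|T|\<close>, where \<open>e(T)\<close> is the largest number of edges of a hypergraph
  with bounded degrees which consists of links of elements of \<open>T\<close>. Maximality forces all other
  elements of the independent set to have small degree outside of what \<open>T\<close> accounts for.\<close>

subsection \<open>Hypergraph containers\<close>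

text \<open>A hypergraph is an index set \<open>X\<close> with a map \<open>E\<close> to vertex
  sets, so distinct indices may carry the same edge; degrees count indices.\<close>

definition deg :: "'e set \<Rightarrow> ('e \<Rightarrow> 'v set) \<Rightarrow> 'v set \<Rightarrow> nat" where
  "deg X E L = card {x \<in> X. L \<subseteq> E x}"

definition multi_hypergraph :: "'v set \<Rightarrow> 'e set \<Rightarrow> ('e \<Rightarrow> 'v set) \<Rightarrow> nat \<Rightarrow> bool" where
  "multi_hypergraph V X E j \<longleftrightarrow>
     finite V \<and> finite X \<and> (\<forall>x\<in>X. E x \<subseteq> V \<and> card (E x) = j)"

text \<open>The co-degree condition of container theorems: \<open>B * p\<close> bounds the vertex
  degrees and each further vertex of \<open>L\<close> costs a factor \<open>p\<close>. Keeping
  \<open>B\<close> and \<open>p\<close> apart lets links have the same form, with only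
  \<open>B\<close> changing to \<open>2 * B * p\<close>.\<close>

definition spread :: "'e set \<Rightarrow> ('e \<Rightarrow> 'v set) \<Rightarrow> real \<Rightarrow> real \<Rightarrow> bool" where
  "spread X E B p \<longleftrightarrow> (\<forall>L. finite L \<longrightarrow> L \<noteq> {} \<longrightarrow> real (deg X E L) \<le> B * p ^ card L)"

definition edge_free :: "'e set \<Rightarrow> ('e \<Rightarrow> 'v set) \<Rightarrow> 'v set \<Rightarrow> bool" where
  "edge_free X E I \<longleftrightarrow> (\<forall>x\<in>X. \<not> E x \<subseteq> I)"

text \<open>Every edge of the link family keeps the index of the edge it comes from, and each index is used
  at most once. If equal links were merged, the bound on the spoilt edges below would fail when
  \<open>B * p ^ j\<close> is much larger than \<open>1\<close>.\<close>

definition link_family ::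
  "'e set \<Rightarrow> ('e \<Rightarrow> 'v set) \<Rightarrow> real \<Rightarrow> real \<Rightarrow> 'v set \<Rightarrow> 'e set \<times> ('e \<Rightarrow> 'v set) \<Rightarrow> bool" where
  "link_family X E B p T YF \<longleftrightarrow>
     fst YF \<subseteq> X \<and> (\<forall>x\<in>fst YF. \<exists>v\<in>T \<inter> E x. snd YF x = E x - {v}) \<and>
     spread (fst YF) (snd YF) (2 * B * p) p"

text \<open>For a given hypergraph this is a fixed choice depending on \<open>T\<close> alone, so a
  container computed from it is determined by the fingerprint.\<close>

definition best_link ::
  "'e set \<Rightarrow> ('e \<Rightarrow> 'v set) \<Rightarrow> real \<Rightarrow> real \<Rightarrow> 'v set \<Rightarrow> 'e set \<times> ('e \<Rightarrow> 'v set)" where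
  "best_link X E B p T = (ARG_MAX (\<lambda>YF. card (fst YF)) YF. link_family X E B p T YF)"

lemma best_link:
  assumes "finite X" "0 \<le> B" "0 < p"
  shows "link_family X E B p T (best_link X E B p T)"
    and "link_family X E B p T YF \<Longrightarrow> card (fst YF) \<le> card (fst (best_link X E B p T))"
proof -
  have "link_family X E B p T ({}, E)"
    using assms by (auto simp: link_family_def spread_def deg_def)
  moreover have "\<forall>YF. link_family X E B p T YF \<longrightarrow> card (fst YF) < Suc (card X)"
    using card_mono[OF assms(1)] by (auto simp: link_family_def less_Suc_eq_le)
  ultimately have *: "link_family X E B p T (best_link X E B p T) \<and>
      (\<forall>YF. link_family X E B p T YF \<longrightarrow> card (fst YF) \<le> card (fst (best_link X E B p T)))"
    unfolding best_link_def by (rule arg_max_nat_lemma)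
  then show "link_family X E B p T (best_link X E B p T)" by blast
  show "card (fst YF) \<le> card (fst (best_link X E B p T))" if "link_family X E B p T YF"
    using * that by blast
qed

lemma card_touching_le:
  assumes "finite X" "finite W" "spread X E B p"
  shows "real (card {x\<in>X. E x \<inter> W \<noteq> {}}) \<le> real (card W) * (B * p)"
proof -
  have eq: "{x\<in>X. E x \<inter> W \<noteq> {}} = (\<Union>w\<in>W. {x\<in>X. {w} \<subseteq> E x})" by auto
  have "card {x\<in>X. E x \<inter> W \<noteq> {}} \<le> (\<Sum>w\<in>W. card {x\<in>X. {w} \<subseteq> E x})"
    unfolding eq by (rule card_UN_le[OF assms(2)])
  then have "real (card {x\<in>X. E x \<inter> W \<noteq> {}}) \<le> (\<Sum>w\<in>W. real (deg X E {w}))"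
    unfolding deg_def of_nat_sum[symmetric] of_nat_le_iff .
  also have "\<dots> \<le> (\<Sum>w\<in>W. B * p)"
    using assms(3) by (intro sum_mono) (metis spread_def card.empty card.insert empty_iff
        finite.emptyI finite.insertI insert_not_empty power_one_right One_nat_def)
  finally show ?thesis by simp
qed

text \<open>The threshold is half of the bound \<open>2 * B * p * p ^ card L\<close> imposed on link
  families. An \<open>L\<close> below it has room for another \<open>B * p ^ Suc (card L)\<close>
  links.\<close>

definition saturated :: "'e set \<Rightarrow> ('e \<Rightarrow> 'v set) \<Rightarrow> real \<Rightarrow> real \<Rightarrow> 'v set set" where
  "saturated Y F B p = {L. finite L \<and> L \<noteq> {} \<and> B * p ^ Suc (card L) < real (deg Y F L)}"

text \<open>For each vertex, the links of all such edges through it can be added to the family at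
  once without breaking its degree bounds.\<close>

definition unspoilt ::
  "'e set \<Rightarrow> ('e \<Rightarrow> 'v set) \<Rightarrow> real \<Rightarrow> real \<Rightarrow> 'e set \<times> ('e \<Rightarrow> 'v set) \<Rightarrow> 'e set" where
  "unspoilt X E B p YF =
     {x \<in> X - fst YF. \<forall>L\<in>saturated (fst YF) (snd YF) B p. \<not> L \<subseteq> E x}"

text \<open>This is the container when the best link family of \<open>T\<close> is small; it refers
  to the independent set only through \<open>T\<close>.\<close>

definition low_degree ::
  "'v set \<Rightarrow> 'e set \<Rightarrow> ('e \<Rightarrow> 'v set) \<Rightarrow> real \<Rightarrow> real \<Rightarrow> real \<Rightarrow> 'v set \<Rightarrow> 'v set" where
  "low_degree V X E B p l T =
     {v\<in>V. real (card {x \<in> unspoilt X E B p (best_link X E B p T). v \<in> E x}) \<le> l}"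

section \<open>Link families and the choice of the fingerprint\<close>

lemma link_family_edges:
  assumes "multi_hypergraph V X E (Suc j)" "link_family X E B p T YF"
  shows "multi_hypergraph V (fst YF) (snd YF) j"
  unfolding multi_hypergraph_def
proof (intro conjI ballI)
  show "finite V" "finite (fst YF)"
    using assms finite_subset by (auto simp: multi_hypergraph_def link_family_def)
next
  fix x assume x: "x \<in> fst YF"
  then obtain v where v: "v \<in> E x" "snd YF x = E x - {v}" and "x \<in> X"
    using assms(2) by (fastforce simp: link_family_def)
  then show "snd YF x \<subseteq> V" "card (snd YF x) = j"
    using assms(1) by (auto simp: multi_hypergraph_def)
qed

lemma link_family_edge_free:
  assumes "link_family X E B p T YF" "edge_free X E I" "T \<subseteq> I"
  shows "edge_free (fst YF) (snd YF) I"
  unfolding edge_free_def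
proof (intro ballI notI)
  fix x assume x: "x \<in> fst YF" and sub: "snd YF x \<subseteq> I"
  obtain v where "v \<in> T" "v \<in> E x" "snd YF x = E x - {v}"
    using assms(1) x by (auto simp: link_family_def)
  with sub assms(3) have "E x \<subseteq> I" by auto
  then show False using assms x by (auto simp: link_family_def edge_free_def)
qed

text \<open>A set \<open>L\<close> inside some new link is not saturated, so its old degree is at
  most half of the allowed one. New links containing \<open>L\<close> come from edges containing
  \<open>insert v L\<close>, and the spread of \<open>X\<close> bounds their number by the other
  half. All other sets keep their degree.\<close>

lemma link_family_insert:
  assumes fin: "finite X" and sp: "spread X E B p"
    and lf: "link_family X E B p T (Y, F)"
    and A: "A = {x \<in> unspoilt X E B p (Y, F). v \<in> E x}"
  shows "link_family X E B p (insert v T) (Y \<union> A, \<lambda>x. if x \<in> Y then F x else E x - {v})"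
    (is "link_family _ _ _ _ _ (_, ?F)")
proof -
  have YX: "Y \<subseteq> X" and AX: "A \<subseteq> X" "Y \<inter> A = {}" and vA: "\<And>x. x \<in> A \<Longrightarrow> v \<in> E x"
    using lf A by (auto simp: link_family_def unspoilt_def)
  have finY: "finite Y" "finite A" using fin YX AX finite_subset by blast+
  have "real (deg (Y \<union> A) ?F L) \<le> 2 * B * p * p ^ card L" if L: "finite L" "L \<noteq> {}" for L
  proof -
    let ?A = "{x\<in>A. L \<subseteq> E x - {v}}"
    have "{x \<in> Y \<union> A. L \<subseteq> ?F x} = {x\<in>Y. L \<subseteq> F x} \<union> ?A" using AX by auto
    then have deq: "deg (Y \<union> A) ?F L = deg Y F L + card ?A"
      unfolding deg_def using finY AX by (simp, subst card_Un_disjoint) auto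
    have degY: "real (deg Y F L) \<le> 2 * B * p * p ^ card L"
      using lf L by (auto simp: link_family_def spread_def)
    show ?thesis
    proof (cases "?A = {}")
      case True
      then show ?thesis using deq degY by (simp only: card.empty)
    next
      case False
      then obtain x where x: "x \<in> A" "L \<subseteq> E x" "v \<notin> L" by blast
      then have "L \<notin> saturated Y F B p" using A by (auto simp: unspoilt_def)
      then have "real (deg Y F L) \<le> B * p ^ Suc (card L)"
        using L by (auto simp: saturated_def)
      moreover have "real (card ?A) \<le> B * p ^ Suc (card L)"
      proof -
        have "card ?A \<le> deg X E (insert v L)"
          unfolding deg_def using fin AX vA by (intro card_mono) auto
        moreover have "real (deg X E (insert v L)) \<le> B * p ^ card (insert v L)"
          using sp L by (auto simp: spread_def)
        ultimately show ?thesis using x L by simp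
      qed
      ultimately show ?thesis using deq by (simp add: algebra_simps)
    qed
  qed
  then have "spread (Y \<union> A) ?F (2 * B * p) p" by (simp add: spread_def)
  moreover have "\<forall>x\<in>Y \<union> A. \<exists>w\<in>insert v T \<inter> E x. ?F x = E x - {w}"
    using lf vA by (fastforce simp: link_family_def)
  ultimately show ?thesis using YX AX by (simp add: link_family_def)
qed

text \<open>\<open>T\<close> maximises the size of the best link family minus
  \<open>l * card T\<close>. Comparison with the empty set bounds \<open>card T\<close>. Comparison
  with \<open>insert v T\<close> shows that \<open>v\<close> lies in at most \<open>l\<close>
  unspoilt edges, since all their links at \<open>v\<close> could be added.\<close>

lemma fingerprint_exists:
  assumes fin: "finite X" "finite V" and sp: "spread X E B p" and pos: "0 \<le> B" "0 < p" "0 < l"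
    and I: "I \<subseteq> V"
  shows "\<exists>T\<subseteq>I. real (card T) * l \<le> real (card (fst (best_link X E B p T))) \<and>
           I \<subseteq> low_degree V X E B p l T"
proof -
  have finI: "finite I" using fin I finite_subset by blast
  let ?w = "\<lambda>T. real (card (fst (best_link X E B p T))) - real (card T) * l"
  have "finite (?w ` Pow I)" "?w ` Pow I \<noteq> {}" using finI by auto
  then have "Max (?w ` Pow I) \<in> ?w ` Pow I" by (rule Max_in)
  then obtain T where T: "T \<subseteq> I" "?w T = Max (?w ` Pow I)" by auto
  then have max: "?w S \<le> ?w T" if "S \<subseteq> I" for S
    using that finI by (metis (no_types, lifting) Max_ge PowI \<open>finite (?w ` Pow I)\<close> imageI)
  have "0 \<le> ?w {}" by simp
  also have "\<dots> \<le> ?w T" using max[of "{}"] by simp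
  finally have 1: "real (card T) * l \<le> real (card (fst (best_link X E B p T)))" by simp
  have "v \<in> low_degree V X E B p l T" if v: "v \<in> I" for v
  proof -
    obtain Y F where YF: "best_link X E B p T = (Y, F)" by fastforce
    define A where "A = {x \<in> unspoilt X E B p (Y, F). v \<in> E x}"
    have lf: "link_family X E B p T (Y, F)"
      using best_link(1)[OF fin(1) pos(1,2)] YF by metis
    have dis: "finite Y" "finite A" "Y \<inter> A = {}"
      using lf fin finite_subset by (auto simp: A_def link_family_def unspoilt_def)
    have "card (Y \<union> A) \<le> card (fst (best_link X E B p (insert v T)))"
      using best_link(2)[OF fin(1) pos(1,2) link_family_insert[OF fin(1) sp lf A_def]] by simp
    then have "real (card Y) + real (card A) \<le> real (card (fst (best_link X E B p (insert v T))))"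
      using dis by (simp add: card_Un_disjoint)
    moreover have "?w (insert v T) \<le> ?w T" using max T v by simp
    \<comment> \<open>The case that \<open>v\<close> already lies in \<open>T\<close> is included,
      hence an inequality.\<close>
    moreover have "real (card (insert v T)) * l \<le> (real (card T) + 1) * l"
      using pos by (intro mult_right_mono) (auto intro: card_insert_le_m1 simp: card_insert_if T finite_subset[OF T(1) finI])
    ultimately have "real (card A) \<le> l" using YF by (simp add: algebra_simps)
    then show ?thesis using YF v I by (auto simp: low_degree_def A_def)
  qed
  then show ?thesis using T(1) 1 by blast
qed

text \<open>Summing the degrees of the saturated sets counts pairs (edge, subset of it), so the number of
  edges destroyed by saturation is controlled without splitting according to the size of the
  saturated sets.\<close>

lemma card_spoilt_le:
  assumes h: "multi_hypergraph V X E (Suc j)" and sp: "spread X E B p"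
    and p: "0 < p" "p \<le> 1" "0 \<le> B"
    and lf: "link_family X E B p T (Y, F)"
  shows "p * (real (card X) - real (card (unspoilt X E B p (Y, F)))) \<le> 2 ^ Suc j * real (card Y)"
proof -
  have fin: "finite X" "finite Y" "Y \<subseteq> X" and hY: "multi_hypergraph V Y F j"
    using h lf link_family_edges[OF h lf] by (auto simp: multi_hypergraph_def link_family_def)
  have cF: "finite (F x)" "card (F x) = j" if "x \<in> Y" for x
    using that hY finite_subset by (auto simp: multi_hypergraph_def)
  let ?S = "saturated Y F B p"
  \<comment> \<open>Saturation is a strict inequality, so a saturated set has positive degree and
    lies inside some link. Hence there are finitely many.\<close>
  have "?S \<subseteq> (\<Union>x\<in>Y. Pow (F x))"
  proof
    fix L assume L: "L \<in> ?S"
    have "deg Y F L \<noteq> 0"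
    proof
      assume "deg Y F L = 0"
      with L have "B * p ^ Suc (card L) < 0" by (simp add: saturated_def)
      then show False using p by (simp add: mult_less_0_iff)
    qed
    then have "{x\<in>Y. L \<subseteq> F x} \<noteq> {}" unfolding deg_def by (metis card.empty)
    then show "L \<in> (\<Union>x\<in>Y. Pow (F x))" by blast
  qed
  then have finS: "finite ?S" by (rule finite_subset) (use fin cF in auto)
  have "(\<Sum>L\<in>?S. deg Y F L) = (\<Sum>L\<in>?S. \<Sum>x\<in>Y. if L \<subseteq> F x then 1 else 0)"
    unfolding deg_def using fin by (intro sum.cong) (auto simp: sum.If_cases Int_def)
  also have "\<dots> = (\<Sum>x\<in>Y. \<Sum>L\<in>?S. if L \<subseteq> F x then 1 else 0)" by (rule sum.swap)
  also have "\<dots> = (\<Sum>x\<in>Y. card {L\<in>?S. L \<subseteq> F x})"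
    using finS by (intro sum.cong) (auto simp: sum.If_cases Int_def)
  also have "\<dots> \<le> (\<Sum>x\<in>Y. 2 ^ j)"
  proof (rule sum_mono)
    fix x assume x: "x \<in> Y"
    have "card {L\<in>?S. L \<subseteq> F x} \<le> card (Pow (F x))" using cF[OF x] by (intro card_mono) auto
    then show "card {L\<in>?S. L \<subseteq> F x} \<le> 2 ^ j" using cF[OF x] by (simp add: card_Pow)
  qed
  finally have sumdeg: "(\<Sum>L\<in>?S. deg Y F L) \<le> 2 ^ j * card Y" by (simp add: mult.commute)
  have "X - unspoilt X E B p (Y, F) \<subseteq> Y \<union> (\<Union>L\<in>?S. {x\<in>X. L \<subseteq> E x})"
    by (auto simp: unspoilt_def)
  then have "card (X - unspoilt X E B p (Y, F)) \<le> card (Y \<union> (\<Union>L\<in>?S. {x\<in>X. L \<subseteq> E x}))"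
    using fin finS by (intro card_mono) auto
  also have "\<dots> \<le> card Y + card (\<Union>L\<in>?S. {x\<in>X. L \<subseteq> E x})" by (rule card_Un_le)
  also have "\<dots> \<le> card Y + (\<Sum>L\<in>?S. deg X E L)"
    unfolding deg_def using card_UN_le[OF finS] by (intro add_left_mono)
  finally have a: "card (X - unspoilt X E B p (Y, F)) \<le> card Y + (\<Sum>L\<in>?S. deg X E L)" .
  have "p * real (\<Sum>L\<in>?S. deg X E L) = (\<Sum>L\<in>?S. p * real (deg X E L))"
    by (simp add: sum_distrib_left)
  \<comment> \<open>The saturation threshold is exactly \<open>p\<close> times the bound that
    \<open>spread\<close> gives for \<open>deg X E L\<close>.\<close>
  also have "\<dots> \<le> (\<Sum>L\<in>?S. real (deg Y F L))"
  proof (rule sum_mono)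
    fix L assume L: "L \<in> ?S"
    have "p * real (deg X E L) \<le> p * (B * p ^ card L)"
      using sp L p by (intro mult_left_mono) (auto simp: spread_def saturated_def)
    also have "\<dots> \<le> real (deg Y F L)" using L by (auto simp: saturated_def algebra_simps)
    finally show "p * real (deg X E L) \<le> real (deg Y F L)" .
  qed
  also have "\<dots> \<le> 2 ^ j * real (card Y)"
    using sumdeg by (metis of_nat_le_iff of_nat_mult of_nat_numeral of_nat_power of_nat_sum)
  finally have b: "p * real (\<Sum>L\<in>?S. deg X E L) \<le> 2 ^ j * real (card Y)" .
  have u: "unspoilt X E B p (Y, F) \<subseteq> X" by (auto simp: unspoilt_def)
  have "real (card X) - real (card (unspoilt X E B p (Y, F))) = real (card (X - unspoilt X E B p (Y, F)))"
    using u fin by (simp add: card_Diff_subset finite_subset card_mono of_nat_diff)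
  also have "\<dots> \<le> real (card Y) + real (\<Sum>L\<in>?S. deg X E L)" using a by linarith
  finally have "p * (real (card X) - real (card (unspoilt X E B p (Y, F))))
      \<le> p * (real (card Y) + real (\<Sum>L\<in>?S. deg X E L))"
    using p by (intro mult_left_mono) auto
  also have "\<dots> \<le> real (card Y) + 2 ^ j * real (card Y)"
    using b p mult_right_mono[of p 1 "real (card Y)"] by (simp add: distrib_left)
  also have "\<dots> \<le> 2 ^ Suc j * real (card Y)"
  proof -
    have "1 * real (card Y) \<le> 2 ^ j * real (card Y)" by (intro mult_right_mono) auto
    then show ?thesis by (simp add: mult.commute)
  qed
  finally show ?thesis .
qed

text \<open>A small link family spoils at most half of the edges. At most \<open>l * card V\<close>,
  a quarter of \<open>card X\<close>, of the unspoilt edges meet the container, so another quarter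
  lies entirely outside. As a vertex is in at most \<open>B * p\<close> edges, the complement must
  be large.\<close>

lemma card_low_degree_complement:
  assumes h: "multi_hypergraph V X E (Suc j)" and sp: "spread X E B p"
    and p: "0 < p" "p \<le> 1" "0 \<le> B"
    and small: "real (card (fst (best_link X E B p T))) \<le> p * real (card X) / 2 ^ (j + 2)"
    and l0: "0 \<le> l" and l: "l * real (card V) \<le> real (card X) / 4"
  shows "real (card X) \<le> 4 * (B * p) * real (card (V - low_degree V X E B p l T))"
proof -
  have fin: "finite X" "finite V" using h by (auto simp: multi_hypergraph_def)
  obtain Y F where YF: "best_link X E B p T = (Y, F)" by fastforce
  have lf: "link_family X E B p T (Y, F)" using best_link(1)[OF fin(1) p(3,1)] YF by metis
  let ?U = "unspoilt X E B p (Y, F)" and ?C = "low_degree V X E B p l T"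
  have U: "?U \<subseteq> X" "finite ?U" using fin by (auto simp: unspoilt_def)
  have "p * (real (card X) - real (card ?U)) \<le> 2 ^ Suc j * real (card Y)"
    by (rule card_spoilt_le[OF h sp p lf])
  also have "\<dots> \<le> 2 ^ Suc j * (p * real (card X) / 2 ^ (j + 2))"
    using small YF by (intro mult_left_mono) auto
  also have "\<dots> = p * (real (card X) / 2)" by (simp add: field_simps)
  finally have "real (card X) - real (card ?U) \<le> real (card X) / 2" using p by simp
  then have half: "real (card X) / 2 \<le> real (card ?U)" by simp
  have finC: "finite ?C" using fin by (simp add: low_degree_def)
  have eq: "{x\<in>?U. E x \<inter> ?C \<noteq> {}} = (\<Union>v\<in>?C. {x\<in>?U. v \<in> E x})" by auto
  have "card {x\<in>?U. E x \<inter> ?C \<noteq> {}} \<le> (\<Sum>v\<in>?C. card {x\<in>?U. v \<in> E x})"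
    unfolding eq by (rule card_UN_le[OF finC])
  then have "real (card {x\<in>?U. E x \<inter> ?C \<noteq> {}}) \<le> (\<Sum>v\<in>?C. real (card {x\<in>?U. v \<in> E x}))"
    unfolding of_nat_sum[symmetric] of_nat_le_iff .
  also have "\<dots> \<le> (\<Sum>v\<in>?C. l)" by (intro sum_mono) (auto simp: low_degree_def YF)
  also have "\<dots> = real (card ?C) * l" by simp
  also have "\<dots> \<le> real (card V) * l"
    using l0 fin by (intro mult_right_mono) (auto simp: low_degree_def intro: card_mono)
  finally have t: "real (card {x\<in>?U. E x \<inter> ?C \<noteq> {}}) \<le> real (card X) / 4"
    using l by (simp add: mult.commute)
  have sum: "card ?U = card ({x\<in>?U. E x \<inter> ?C \<noteq> {}} \<union> {x\<in>?U. E x \<inter> ?C = {}})"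
    by (rule arg_cong[of _ _ card]) auto
  have un: "card ({x\<in>?U. E x \<inter> ?C \<noteq> {}} \<union> {x\<in>?U. E x \<inter> ?C = {}})
      \<le> card {x\<in>?U. E x \<inter> ?C \<noteq> {}} + card {x\<in>?U. E x \<inter> ?C = {}}"
    by (rule card_Un_le)
  have mono: "card {x\<in>?U. E x \<inter> ?C = {}} \<le> card {x\<in>X. E x \<inter> (V - ?C) \<noteq> {}}"
  proof (rule card_mono)
    show "{x\<in>?U. E x \<inter> ?C = {}} \<subseteq> {x\<in>X. E x \<inter> (V - ?C) \<noteq> {}}"
    proof
      fix x assume x: "x \<in> {x\<in>?U. E x \<inter> ?C = {}}"
      then have "x \<in> X" using U by auto
      \<comment> \<open>Edges have \<open>Suc j\<close> elements, so an edge that misses the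
        container does meet the complement.\<close>
      then have "E x \<subseteq> V" "E x \<noteq> {}" using h by (auto simp: multi_hypergraph_def)
      with x \<open>x \<in> X\<close> show "x \<in> {x\<in>X. E x \<inter> (V - ?C) \<noteq> {}}" by auto
    qed
  qed (use fin in auto)
  have "real (card X) / 4 \<le> real (card {x\<in>X. E x \<inter> (V - ?C) \<noteq> {}})"
    using half t sum un mono by linarith
  also have "\<dots> \<le> real (card (V - ?C)) * (B * p)"
    by (rule card_touching_le) (use fin sp in auto)
  finally have "real (card X) / 4 \<le> real (card (V - ?C)) * (B * p)" .
  then show ?thesis by (simp add: mult_ac)
qed

text \<open>Fingerprints form a list because every level of the induction and every round of the
  iteration contributes its own. The container \<open>C Ts\<close> is a function of the list only,
  which makes a union bound over fingerprints possible.\<close>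

definition captured ::
  "'v set \<Rightarrow> nat \<Rightarrow> real \<Rightarrow> ('v set list \<Rightarrow> 'v set) \<Rightarrow> ('v set \<Rightarrow> bool) \<Rightarrow> 'v set \<Rightarrow> bool" where
  "captured V k t C Q I \<longleftrightarrow>
     (\<exists>Ts. length Ts = k \<and> (\<forall>T\<in>set Ts. T \<subseteq> I \<and> real (card T) \<le> t) \<and>
           I \<subseteq> C Ts \<and> C Ts \<subseteq> V \<and> Q (C Ts))"

section \<open>Shrinking the container once and then repeatedly\<close>

lemma card_edges_le:
  assumes "multi_hypergraph V X E j" "spread X E B p" "\<And>x. x \<in> X \<Longrightarrow> E x \<noteq> {}"
  shows "real (card X) \<le> real (card V) * (B * p)"
proof -
  have "{x\<in>X. E x \<inter> V \<noteq> {}} = X" using assms by (auto simp: multi_hypergraph_def)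
  then show ?thesis using card_touching_le[of X V E B p] assms by (simp add: multi_hypergraph_def)
qed

text \<open>Induction on the uniformity. If the best link family of the fingerprint is big, it is a
  dense \<open>j\<close>-uniform hypergraph in which \<open>I\<close> is still edge-free, and the
  induction hypothesis applies to it. Otherwise the low-degree set is already a container.\<close>

lemma container_once:
  fixes \<rho> :: real
  assumes "0 < \<rho>"
  shows "\<exists>\<delta> \<kappa>. 0 < \<delta> \<and> \<delta> \<le> 1 \<and> 0 < \<kappa> \<and>
     (\<forall>(V :: 'v set) (X :: 'e set) E p B.
        multi_hypergraph V X E j \<longrightarrow> spread X E B p \<longrightarrow> 0 < p \<longrightarrow> p \<le> 1 \<longrightarrow> 0 \<le> B \<longrightarrow> X \<noteq> {} \<longrightarrow>
        \<rho> * (B * p) * real (card V) \<le> real (card X) \<longrightarrow>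
        (\<exists>C. \<forall>I\<subseteq>V. edge_free X E I \<longrightarrow>
           captured V j (\<kappa> * p * real (card V)) C
             (\<lambda>W. real (card W) \<le> (1 - \<delta>) * real (card V)) I))"
  using assms
proof (induction j arbitrary: \<rho>)
  case 0
  \<comment> \<open>Edges of size zero are empty and lie in every \<open>I\<close>.\<close>
  have "\<not> edge_free X E I" if "multi_hypergraph V X E 0" "X \<noteq> {}"
    for V :: "'v set" and X :: "'e set" and E I
    using that finite_subset by (fastforce simp: multi_hypergraph_def edge_free_def)
  then show ?case by (intro exI[of _ 1]) auto
next
  case (Suc j)
  \<comment> \<open>The factor \<open>2 ^ (j + 2)\<close> comes from the threshold in
    \<open>big\<close>, one more factor 2 from the spread constant \<open>2 * B * p\<close> of the
    links.\<close>
  define \<rho>' where "\<rho>' = \<rho> / 2 ^ (j + 3)"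
  have "0 < \<rho>'" using Suc.prems by (simp add: \<rho>'_def)
  from Suc.IH[OF this] obtain \<delta>' \<kappa>' where c: "0 < \<delta>'" "\<delta>' \<le> 1" "0 < \<kappa>'" and
    IH: "\<forall>(V :: 'v set) (X :: 'e set) E p B.
        multi_hypergraph V X E j \<longrightarrow> spread X E B p \<longrightarrow> 0 < p \<longrightarrow> p \<le> 1 \<longrightarrow> 0 \<le> B \<longrightarrow> X \<noteq> {} \<longrightarrow>
        \<rho>' * (B * p) * real (card V) \<le> real (card X) \<longrightarrow>
        (\<exists>C. \<forall>I\<subseteq>V. edge_free X E I \<longrightarrow>
           captured V j (\<kappa>' * p * real (card V)) C
             (\<lambda>W. real (card W) \<le> (1 - \<delta>') * real (card V)) I)"
    by (elim exE conjE) (rule that)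
  \<comment> \<open>The constants have to serve both branches: \<delta>' and \<kappa>' come from the
    induction, \<rho>/4 from \<open>card_low_degree_complement\<close>, and 8/\<rho> from the size
    of the fingerprint chosen at this level.\<close>
  define \<delta> where "\<delta> = min \<delta>' (\<rho> / 4)"
  define \<kappa> where "\<kappa> = max \<kappa>' (8 / \<rho>)"
  have dk: "0 < \<delta>" "\<delta> \<le> 1" "0 < \<kappa>" using c Suc.prems by (auto simp: \<delta>_def \<kappa>_def)
  have step: "\<exists>C. \<forall>I\<subseteq>V. edge_free X E I \<longrightarrow>
           captured V (Suc j) (\<kappa> * p * real (card V)) C
             (\<lambda>W. real (card W) \<le> (1 - \<delta>) * real (card V)) I"
    if h: "multi_hypergraph V X E (Suc j)" and sp: "spread X E B p" and p: "0 < p" "p \<le> 1"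
      and B0: "0 \<le> B" and X: "X \<noteq> {}" and dense: "\<rho> * (B * p) * real (card V) \<le> real (card X)"
    for V :: "'v set" and X :: "'e set" and E p B
  proof -
    let ?N = "real (card V)"
    have fin: "finite V" "finite X" using h by (auto simp: multi_hypergraph_def)
    have X0: "0 < real (card X)" using fin X by (simp add: card_gt_0_iff)
    have "real (card X) \<le> ?N * (B * p)"
      by (rule card_edges_le[OF h sp]) (use h in \<open>auto simp: multi_hypergraph_def\<close>)
    with X0 have "0 < ?N * (B * p)" by linarith
    then have N0: "0 < ?N" and Bp: "0 < B * p"
      using p B0 by (auto simp: zero_less_mult_iff)
    define l where "l = real (card X) / (4 * ?N)"
    have l: "0 < l" "l * ?N = real (card X) / 4" using X0 N0 by (auto simp: l_def)
    define G where "G T = best_link X E B p T" for T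
    define big where "big T \<longleftrightarrow> p * real (card X) / 2 ^ (j + 2) < real (card (fst (G T)))" for T
    have lf: "link_family X E B p T (G T)" for T
      unfolding G_def by (rule best_link(1)) (use fin B0 p in auto)
    have hG: "multi_hypergraph V (fst (G T)) (snd (G T)) j" for T
      by (rule link_family_edges[OF h lf])
    have spG: "spread (fst (G T)) (snd (G T)) (2 * B * p) p" for T
      using lf by (simp add: link_family_def)
    \<comment> \<open>A container function is fixed for every \<open>T\<close> with a big link
      family before any independent set is considered.\<close>
    have "\<exists>C. big T \<longrightarrow> (\<forall>I\<subseteq>V. edge_free (fst (G T)) (snd (G T)) I \<longrightarrow>
           captured V j (\<kappa>' * p * ?N) C (\<lambda>W. real (card W) \<le> (1 - \<delta>') * ?N) I)" for T
    proof (cases "big T")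
      case True
      have "\<rho>' * (2 * B * p * p) * ?N = p * (\<rho> * (B * p) * ?N) / 2 ^ (j + 2)"
        by (simp add: \<rho>'_def power_add field_simps)
      also have "\<dots> \<le> p * real (card X) / 2 ^ (j + 2)"
        using dense p by (intro divide_right_mono mult_left_mono) auto
      also have "\<dots> \<le> real (card (fst (G T)))" using True by (simp add: big_def)
      finally have d: "\<rho>' * (2 * B * p * p) * ?N \<le> real (card (fst (G T)))" .
      have "fst (G T) \<noteq> {}"
      proof
        assume "fst (G T) = {}"
        with True have "p * real (card X) / 2 ^ (j + 2) < 0" by (simp add: big_def)
        moreover have "0 \<le> p * real (card X) / 2 ^ (j + 2)" using p by simp
        ultimately show False by linarith
      qed
      then show ?thesis using IH[rule_format, OF hG spG p _ _ d] B0 p by auto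
    qed auto
    then obtain C' where C': "\<And>T I. big T \<Longrightarrow> I \<subseteq> V \<Longrightarrow> edge_free (fst (G T)) (snd (G T)) I \<Longrightarrow>
           captured V j (\<kappa>' * p * ?N) (C' T) (\<lambda>W. real (card W) \<le> (1 - \<delta>') * ?N) I"
      by metis
    \<comment> \<open>The head of the list is the fingerprint of this level and alone decides the
      branch; the tail is the list for the link family.\<close>
    define C where "C Ts = (if big (hd Ts) then C' (hd Ts) (tl Ts)
                            else low_degree V X E B p l (hd Ts))" for Ts
    have "captured V (Suc j) (\<kappa> * p * ?N) C (\<lambda>W. real (card W) \<le> (1 - \<delta>) * ?N) I"
      if I: "I \<subseteq> V" and ef: "edge_free X E I" for I
    proof -
      obtain T where T: "T \<subseteq> I" "real (card T) * l \<le> real (card (fst (G T)))"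
          "I \<subseteq> low_degree V X E B p l T"
        using fingerprint_exists[OF fin(2,1) sp B0 p(1) l(1) I] unfolding G_def by blast
      have efG: "edge_free (fst (G T)) (snd (G T)) I" by (rule link_family_edge_free[OF lf ef T(1)])
      \<comment> \<open>Links are nonempty because an empty one would lie in \<open>I\<close>; for
        \<open>j = 0\<close> this leaves no links at all.\<close>
      have "real (card (fst (G T))) \<le> ?N * (2 * B * p * p)"
        by (rule card_edges_le[OF hG spG]) (use efG in \<open>auto simp: edge_free_def\<close>)
      with T(2) have "real (card T) * l \<le> ?N * (2 * B * p * p)" by linarith
      then have "real (card T) * l * (4 * ?N) \<le> ?N * (2 * B * p * p) * (4 * ?N)"
        using N0 by (intro mult_right_mono) auto
      then have "real (card T) * real (card X) \<le> (8 * p * ?N) * (B * p * ?N)"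
        using N0 by (simp add: l_def algebra_simps)
      also have "\<dots> \<le> (8 * p * ?N) * (real (card X) / \<rho>)"
        using dense Suc.prems p by (intro mult_left_mono) (auto simp: field_simps)
      finally have "real (card T) \<le> 8 / \<rho> * p * ?N"
        using X0 Suc.prems by (simp add: field_simps)
      also have "\<dots> \<le> \<kappa> * p * ?N" using p by (intro mult_right_mono) (auto simp: \<kappa>_def)
      finally have cT: "real (card T) \<le> \<kappa> * p * ?N" .
      show ?thesis
      proof (cases "big T")
        case True
        obtain Ts where Ts: "length Ts = j" "\<And>S. S \<in> set Ts \<Longrightarrow> S \<subseteq> I \<and> real (card S) \<le> \<kappa>' * p * ?N"
            "I \<subseteq> C' T Ts" "C' T Ts \<subseteq> V" "real (card (C' T Ts)) \<le> (1 - \<delta>') * ?N"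
          using C'[OF True I efG] unfolding captured_def by blast
        have "\<kappa>' * p * ?N \<le> \<kappa> * p * ?N" using p by (intro mult_right_mono) (auto simp: \<kappa>_def)
        moreover have "(1 - \<delta>') * ?N \<le> (1 - \<delta>) * ?N" by (intro mult_right_mono) (auto simp: \<delta>_def)
        ultimately show ?thesis unfolding captured_def
          using Ts T(1) cT True by (intro exI[of _ "T # Ts"]) (auto simp: C_def intro: order_trans)
      next
        case False
        let ?L = "low_degree V X E B p l T"
        have LV: "?L \<subseteq> V" by (auto simp: low_degree_def)
        have "\<rho> * (B * p) * ?N \<le> 4 * (B * p) * real (card (V - ?L))"
          using card_low_degree_complement[OF h sp p B0, of T l] False l dense
          by (simp add: big_def G_def)
        then have "(B * p) * (\<rho> * ?N) \<le> (B * p) * (4 * real (card (V - ?L)))"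
          by (simp add: mult_ac)
        then have "\<rho> * ?N \<le> 4 * real (card (V - ?L))" using Bp by (simp only: mult_le_cancel_left_pos)
        moreover have "real (card (V - ?L)) = ?N - real (card ?L)"
          using LV fin by (simp add: card_Diff_subset finite_subset card_mono of_nat_diff)
        ultimately have "real (card ?L) \<le> (1 - \<rho> / 4) * ?N" by (simp add: algebra_simps)
        also have "\<dots> \<le> (1 - \<delta>) * ?N" by (intro mult_right_mono) (auto simp: \<delta>_def)
        finally have "real (card ?L) \<le> (1 - \<delta>) * ?N" .
        moreover have "0 \<le> \<kappa> * p * ?N" using dk p by simp
        ultimately show ?thesis unfolding captured_def
          \<comment> \<open>Empty sets pad the list to length \<open>Suc j\<close>.\<close>
          using T cT False LV
          by (intro exI[of _ "T # replicate j {}"]) (auto simp: C_def)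
      qed
    qed
    then show ?thesis by blast
  qed
  show ?case
    by (intro exI[of _ \<delta>] exI[of _ \<kappa>] conjI allI impI; (rule dk | (rule step; assumption)))
qed

lemma multi_hypergraph_restrict:
  assumes "multi_hypergraph V X E j" "W \<subseteq> V"
  shows "multi_hypergraph W {x\<in>X. E x \<subseteq> W} E j"
  using assms by (auto simp: multi_hypergraph_def intro: finite_subset)

lemma spread_restrict:
  assumes "finite X" "spread X E B p" "Y \<subseteq> X"
  shows "spread Y E B p"
  unfolding spread_def
proof (intro allI impI)
  fix L :: "'b set" assume L: "finite L" "L \<noteq> {}"
  have "deg Y E L \<le> deg X E L"
    unfolding deg_def using assms by (intro card_mono) auto
  also have "real (deg X E L) \<le> B * p ^ card L" using assms L by (auto simp: spread_def)
  finally show "real (deg Y E L) \<le> B * p ^ card L" by simp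
qed

text \<open>While a container \<open>W\<close> spans more than \<open>\<epsilon> * card X\<close>
  edges, the hypergraph induced on \<open>W\<close> is dense enough for
  \<open>container_once\<close> with \<rho>\<epsilon> in place of \<rho>, so \<open>W\<close>
  shrinks by the factor 1 - \<delta>. The number of rounds is bounded independently of the
  hypergraph.\<close>

theorem containers:
  fixes \<rho> \<epsilon> :: real
  assumes "0 < \<rho>" "0 < \<epsilon>" "0 < s"
  shows "\<exists>k \<kappa>. 0 < \<kappa> \<and>
     (\<forall>(V :: 'v set) (X :: 'e set) E p B.
        multi_hypergraph V X E s \<longrightarrow> spread X E B p \<longrightarrow> 0 < p \<longrightarrow> p \<le> 1 \<longrightarrow> 0 \<le> B \<longrightarrow>
        \<rho> * (B * p) * real (card V) \<le> real (card X) \<longrightarrow>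
        (\<exists>C. \<forall>I\<subseteq>V. edge_free X E I \<longrightarrow>
           captured V k (\<kappa> * p * real (card V)) C
             (\<lambda>W. real (card {x\<in>X. E x \<subseteq> W}) \<le> \<epsilon> * real (card X)) I))"
proof -
  have "0 < \<rho> * \<epsilon>" using assms by simp
  from container_once[OF this, of s] obtain \<delta> \<kappa> where dk: "0 < \<delta>" "\<delta> \<le> 1" "0 < \<kappa>" and
    once: "\<forall>(V :: 'v set) (X :: 'e set) E p B.
        multi_hypergraph V X E s \<longrightarrow> spread X E B p \<longrightarrow> 0 < p \<longrightarrow> p \<le> 1 \<longrightarrow> 0 \<le> B \<longrightarrow> X \<noteq> {} \<longrightarrow>
        \<rho> * \<epsilon> * (B * p) * real (card V) \<le> real (card X) \<longrightarrow>
        (\<exists>C. \<forall>I\<subseteq>V. edge_free X E I \<longrightarrow>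
           captured V s (\<kappa> * p * real (card V)) C
             (\<lambda>W. real (card W) \<le> (1 - \<delta>) * real (card V)) I)"
    by (elim exE conjE) (rule that)
  \<comment> \<open>After \<open>m\<close> rounds a container is so small that the vertex degrees
    alone leave at most \<open>\<epsilon> * card X\<close> edges inside it.\<close>
  obtain m where m: "(1 - \<delta>) ^ m < \<rho> * \<epsilon>"
    using real_arch_pow_inv[of "\<rho> * \<epsilon>" "1 - \<delta>"] \<open>0 < \<rho> * \<epsilon>\<close> dk by auto
  have step: "\<exists>C. \<forall>I\<subseteq>V. edge_free X E I \<longrightarrow>
           captured V (m * s) (\<kappa> * p * real (card V)) C
             (\<lambda>W. real (card {x\<in>X. E x \<subseteq> W}) \<le> \<epsilon> * real (card X)) I"
    if h: "multi_hypergraph V X E s" and sp: "spread X E B p" and p: "0 < p" "p \<le> 1"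
      and B0: "0 \<le> B" and dense: "\<rho> * (B * p) * real (card V) \<le> real (card X)"
    for V :: "'v set" and X :: "'e set" and E p B
  proof -
    let ?N = "real (card V)" and ?X = "\<lambda>W. {x\<in>X. E x \<subseteq> W}"
    let ?few = "\<lambda>W. real (card (?X W)) \<le> \<epsilon> * real (card X)"
    have fin: "finite V" "finite X" using h by (auto simp: multi_hypergraph_def)
    have iter: "\<exists>C. \<forall>I\<subseteq>V. edge_free X E I \<longrightarrow>
        captured V (i * s) (\<kappa> * p * ?N) C (\<lambda>W. ?few W \<or> real (card W) \<le> (1 - \<delta>) ^ i * ?N) I" for i
    proof (induction i)
      case 0
      then show ?case by (auto simp: captured_def intro!: exI[of _ "\<lambda>_. V"])
    next
      case (Suc i)
      then obtain C where C: "\<And>I. I \<subseteq> V \<Longrightarrow> edge_free X E I \<Longrightarrow>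
        captured V (i * s) (\<kappa> * p * ?N) C (\<lambda>W. ?few W \<or> real (card W) \<le> (1 - \<delta>) ^ i * ?N) I"
        by blast
      have one: "\<exists>D. \<forall>I\<subseteq>W. edge_free (?X W) E I \<longrightarrow>
              captured W s (\<kappa> * p * real (card W)) D
                (\<lambda>U. real (card U) \<le> (1 - \<delta>) * real (card W)) I"
        if W: "W \<subseteq> V" "\<not> ?few W" for W
      proof -
        have cW: "real (card W) \<le> ?N" using W fin by (simp add: card_mono)
        have "\<rho> * \<epsilon> * (B * p) * real (card W) \<le> \<rho> * \<epsilon> * (B * p) * ?N"
          using cW assms B0 p by (intro mult_left_mono) auto
        also have "\<dots> = \<epsilon> * (\<rho> * (B * p) * ?N)" by simp
        also have "\<dots> \<le> \<epsilon> * real (card X)" using dense assms by (intro mult_left_mono) auto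
        also have "\<dots> \<le> real (card (?X W))" using W by simp
        finally have d: "\<rho> * \<epsilon> * (B * p) * real (card W) \<le> real (card (?X W))" .
        have "?X W \<noteq> {}"
        proof
          assume "?X W = {}"
          then have "\<epsilon> * real (card X) < 0" using W by (simp only: card.empty)
          then show False using assms by (simp add: mult_less_0_iff)
        qed
        moreover have "spread (?X W) E B p" by (rule spread_restrict[OF fin(2) sp]) auto
        ultimately show ?thesis
          using once[rule_format, OF multi_hypergraph_restrict[OF h W(1)] _ p B0 _ d] by blast
      qed
      then have "\<forall>W. \<exists>D. W \<subseteq> V \<and> \<not> ?few W \<longrightarrow> (\<forall>I\<subseteq>W. edge_free (?X W) E I \<longrightarrow>
              captured W s (\<kappa> * p * real (card W)) D
                (\<lambda>U. real (card U) \<le> (1 - \<delta>) * real (card W)) I)"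
        by blast
      from choice[OF this] obtain D where D: "\<forall>W. W \<subseteq> V \<and> \<not> ?few W \<longrightarrow>
            (\<forall>I\<subseteq>W. edge_free (?X W) E I \<longrightarrow>
              captured W s (\<kappa> * p * real (card W)) (D W)
                (\<lambda>U. real (card U) \<le> (1 - \<delta>) * real (card W)) I)"
        by (elim exE) (rule that)
      \<comment> \<open>The first \<open>i * s\<close> sets determine the current container, the
        last \<open>s\<close> sets a container inside it. When nothing is left to do, the last sets
        are padding.\<close>
      define C' where "C' Ts = (let W = C (take (i * s) Ts) in
                          if ?few W then W else D W (drop (i * s) Ts))" for Ts
      have "captured V (Suc i * s) (\<kappa> * p * ?N) C'
              (\<lambda>W. ?few W \<or> real (card W) \<le> (1 - \<delta>) ^ Suc i * ?N) I"
        if I: "I \<subseteq> V" and ef: "edge_free X E I" for I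
      proof -
        obtain Ts where Ts: "length Ts = i * s" "\<forall>T\<in>set Ts. T \<subseteq> I \<and> real (card T) \<le> \<kappa> * p * ?N"
            "I \<subseteq> C Ts" "C Ts \<subseteq> V" and Q: "?few (C Ts) \<or> real (card (C Ts)) \<le> (1 - \<delta>) ^ i * ?N"
          using C[OF I ef] unfolding captured_def by blast
        show ?thesis
        proof (cases "?few (C Ts)")
          case True
          have "0 \<le> \<kappa> * p * ?N" using dk p by simp
          then show ?thesis unfolding captured_def using Ts True
            by (intro exI[of _ "Ts @ replicate s {}"]) (auto simp: C'_def)
        next
          case False
          have "edge_free (?X (C Ts)) E I" using ef by (auto simp: edge_free_def)
          from D[rule_format, OF conjI[OF Ts(4) False] Ts(3) this] obtain Us where Us: "length Us = s"
            "\<forall>T\<in>set Us. T \<subseteq> I \<and> real (card T) \<le> \<kappa> * p * real (card (C Ts))"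
            "I \<subseteq> D (C Ts) Us" "D (C Ts) Us \<subseteq> C Ts"
            "real (card (D (C Ts) Us)) \<le> (1 - \<delta>) * real (card (C Ts))"
            unfolding captured_def by blast
          have "real (card (C Ts)) \<le> ?N" using Ts fin by (simp add: card_mono)
          then have le: "\<kappa> * p * real (card (C Ts)) \<le> \<kappa> * p * ?N"
            using dk p by (intro mult_left_mono) auto
          have "(1 - \<delta>) * real (card (C Ts)) \<le> (1 - \<delta>) * ((1 - \<delta>) ^ i * ?N)"
            using False Q dk by (intro mult_left_mono) auto
          then have "real (card (D (C Ts) Us)) \<le> (1 - \<delta>) ^ Suc i * ?N" using Us(5) by simp
          then show ?thesis unfolding captured_def using Ts Us le False
            by (intro exI[of _ "Ts @ Us"]) (auto simp: C'_def intro: order_trans)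
        qed
      qed
      then show ?case by blast
    qed
    have final: "?few W" if W: "W \<subseteq> V" "real (card W) \<le> (1 - \<delta>) ^ m * ?N" for W
    proof -
      have "real (card (?X W)) \<le> real (card W) * (B * p)"
      proof (rule card_edges_le)
        show "multi_hypergraph W (?X W) E s" by (rule multi_hypergraph_restrict[OF h W(1)])
        show "spread (?X W) E B p" by (rule spread_restrict[OF fin(2) sp]) auto
      qed (use h assms(3) in \<open>auto simp: multi_hypergraph_def\<close>)
      also have "\<dots> \<le> (1 - \<delta>) ^ m * ?N * (B * p)"
        using W B0 p by (intro mult_right_mono) auto
      also have "\<dots> \<le> \<rho> * \<epsilon> * ?N * (B * p)"
        using m B0 p by (intro mult_right_mono) auto
      also have "\<dots> = \<epsilon> * (\<rho> * (B * p) * ?N)" by simp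
      also have "\<dots> \<le> \<epsilon> * real (card X)" using dense assms by (intro mult_left_mono) auto
      finally show ?thesis .
    qed
    obtain C where C: "\<And>I. I \<subseteq> V \<Longrightarrow> edge_free X E I \<Longrightarrow>
        captured V (m * s) (\<kappa> * p * ?N) C (\<lambda>W. ?few W \<or> real (card W) \<le> (1 - \<delta>) ^ m * ?N) I"
      using iter[of m] by blast
    have "captured V (m * s) (\<kappa> * p * ?N) C ?few I" if "I \<subseteq> V" "edge_free X E I" for I
      using C[OF that] final unfolding captured_def by blast
    then show ?thesis by blast
  qed
  show ?thesis
    by (intro exI[of _ "m * s"] exI[of _ \<kappa>] conjI allI impI; (rule dk | (rule step; assumption)))
qed

subsection \<open>The union bound over fingerprints\<close>

lemma sum_power_card_Pow:
  fixes x :: "'b :: comm_semiring_1"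
  assumes "finite A"
  shows "(\<Sum>F\<in>Pow A. x ^ card F) = (1 + x) ^ card A"
  using assms
proof induction
  case empty
  then show ?case by simp
next
  case (insert a A)
  have inj: "inj_on (insert a) (Pow A)" using insert.hyps by (auto simp: inj_on_def)
  have "Pow A \<inter> insert a ` Pow A = {}" using insert.hyps by auto
  then have "(\<Sum>F\<in>Pow (insert a A). x ^ card F)
      = (\<Sum>F\<in>Pow A. x ^ card F) + (\<Sum>F\<in>insert a ` Pow A. x ^ card F)"
    unfolding Pow_insert using insert.hyps by (intro sum.union_disjoint) auto
  also have "(\<Sum>F\<in>insert a ` Pow A. x ^ card F) = (\<Sum>F\<in>Pow A. x ^ card (insert a F))"
    by (simp add: sum.reindex[OF inj])
  also have "\<dots> = (\<Sum>F\<in>Pow A. x * x ^ card F)"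
  proof (rule sum.cong)
    fix F assume "F \<in> Pow A"
    then have "finite F" "a \<notin> F" using insert.hyps finite_subset by auto
    then show "x ^ card (insert a F) = x * x ^ card F" by simp
  qed simp
  finally show ?case using insert by (simp add: sum_distrib_left[symmetric] algebra_simps)
qed

text \<open>Independence of the trials. The sets \<open>U\<close> and \<open>D\<close> may overlap:
  then the event is impossible, and the bound still holds.\<close>

lemma prob_contains_avoids:
  assumes fin: "finite V" and p: "0 \<le> p" "p \<le> 1" and sub: "U \<subseteq> V" "D \<subseteq> V"
  shows "measure_pmf.prob (Pi_pmf V False (\<lambda>_. bernoulli_pmf p))
           {Y. (\<forall>e\<in>U. Y e) \<and> (\<forall>e\<in>D. \<not> Y e)} \<le> p ^ card U * (1 - p) ^ card D"
proof -
  let ?B = "\<lambda>e. {b. (e \<in> U \<longrightarrow> b) \<and> (e \<in> D \<longrightarrow> \<not> b)}"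
  have eq: "{Y. (\<forall>e\<in>U. Y e) \<and> (\<forall>e\<in>D. \<not> Y e)} = Pi V ?B" using sub by auto
  have "measure_pmf.prob (Pi_pmf V False (\<lambda>_. bernoulli_pmf p))
      {Y. (\<forall>e\<in>U. Y e) \<and> (\<forall>e\<in>D. \<not> Y e)} = (\<Prod>e\<in>V. measure_pmf.prob (bernoulli_pmf p) (?B e))"
    unfolding eq by (rule measure_Pi_pmf_Pi[OF fin])
  also have "\<dots> \<le> (\<Prod>e\<in>V. (if e \<in> U then p else 1) * (if e \<in> D then 1 - p else 1))"
  proof (rule prod_mono)
    fix e
    have eq: "{b. b} = {True}" "{b. \<not> b} = {False}" by auto
    have "measure_pmf.prob (bernoulli_pmf p) {b. b} = p"
      "measure_pmf.prob (bernoulli_pmf p) {b. \<not> b} = 1 - p"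
      unfolding eq using p by (simp_all add: measure_pmf_single)
    then show "0 \<le> measure_pmf.prob (bernoulli_pmf p) (?B e) \<and>
        measure_pmf.prob (bernoulli_pmf p) (?B e) \<le> (if e \<in> U then p else 1) * (if e \<in> D then 1 - p else 1)"
      using p by auto
  qed
  also have "\<dots> = p ^ card U * (1 - p) ^ card D"
  proof -
    have "V \<inter> {e. e \<in> U} = U" "V \<inter> {e. e \<in> D} = D" using sub by auto
    then show ?thesis using fin by (simp add: prod.distrib prod.If_cases)
  qed
  finally show ?thesis .
qed

text \<open>Group the lists by their union \<open>F\<close>. At most \<open>(2 ^ card F) ^ k\<close>
  lists consist of subsets of \<open>F\<close>, so the group weighs at most
  \<open>(2 ^ k * x) ^ card F\<close>, and the binomial theorem sums this over
  \<open>F\<close>.\<close>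

lemma sum_lists_union_le:
  fixes x :: real
  assumes fin: "finite V" and x: "0 \<le> x"
  shows "(\<Sum>Ts\<in>{Ts. set Ts \<subseteq> Pow V \<and> length Ts = k}. x ^ card (\<Union>(set Ts))) \<le> (1 + 2 ^ k * x) ^ card V"
proof -
  let ?L = "\<lambda>F. {Ts. set Ts \<subseteq> Pow F \<and> length Ts = k}"
  have finL: "finite (?L F)" if "F \<subseteq> V" for F
    using that fin finite_subset by (intro finite_lists_length_eq) auto
  have cardL: "card (?L F) = (2 ^ card F) ^ k" if "F \<subseteq> V" for F
    using that fin finite_subset by (subst card_lists_length_eq) (auto simp: card_Pow)
  have "(\<Sum>Ts\<in>?L V. x ^ card (\<Union>(set Ts)))
      = (\<Sum>F\<in>Pow V. \<Sum>Ts\<in>{Ts\<in>?L V. \<Union>(set Ts) = F}. x ^ card (\<Union>(set Ts)))"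
    using finL[of V] fin by (intro sum.group[symmetric]) auto
  also have "\<dots> \<le> (\<Sum>F\<in>Pow V. (2 ^ k * x) ^ card F)"
  proof (rule sum_mono)
    fix F assume F: "F \<in> Pow V"
    have "(\<Sum>Ts\<in>{Ts\<in>?L V. \<Union>(set Ts) = F}. x ^ card (\<Union>(set Ts)))
        = real (card {Ts\<in>?L V. \<Union>(set Ts) = F}) * x ^ card F" by simp
    also have "\<dots> \<le> real (card (?L F)) * x ^ card F"
      using x F finL[of F] by (intro mult_right_mono) (auto intro!: card_mono)
    also have "\<dots> = (2 ^ k * x) ^ card F"
      using F cardL[of F] by (simp add: power_mult_distrib power_mult[symmetric] mult.commute)
    finally show "(\<Sum>Ts\<in>{Ts\<in>?L V. \<Union>(set Ts) = F}. x ^ card (\<Union>(set Ts))) \<le> (2 ^ k * x) ^ card F" .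
  qed
  also have "\<dots> = (1 + 2 ^ k * x) ^ card V" by (rule sum_power_card_Pow[OF fin])
  finally show ?thesis .
qed

text \<open>The factor \<open>y\<close> is a free parameter: multiplying the term of a family with union \<open>U\<close> by
  \<open>y powr (card U - k * t) \<ge> 1\<close> replaces the estimation of a partial sum of binomial coefficients.\<close>

lemma prob_fingerprint_le:
  fixes p y t d :: real
  assumes fin: "finite V" and p: "0 \<le> p" "p \<le> 1" and y: "0 < y" "y \<le> 1"
    and cover: "\<And>Y. Y \<in> A \<Longrightarrow> \<exists>Ts. length Ts = k \<and>
          (\<forall>T\<in>set Ts. T \<subseteq> V \<and> real (card T) \<le> t \<and> (\<forall>e\<in>T. Y e)) \<and>
          D Ts \<subseteq> V \<and> d \<le> real (card (D Ts)) \<and> (\<forall>e\<in>D Ts. \<not> Y e)"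
  shows "measure_pmf.prob (Pi_pmf V False (\<lambda>_. bernoulli_pmf p)) A
           \<le> exp (- (p * d)) * y powr (- (real k * t)) * exp (2 ^ k * (p * y) * real (card V))"
proof -
  let ?P = "measure_pmf.prob (Pi_pmf V False (\<lambda>_. bernoulli_pmf p))"
  define L where "L = {Ts. set Ts \<subseteq> Pow V \<and> length Ts = k}"
  define R where "R = {Ts\<in>L. (\<forall>T\<in>set Ts. real (card T) \<le> t) \<and> D Ts \<subseteq> V \<and> d \<le> real (card (D Ts))}"
  let ?ev = "\<lambda>Ts. {Y. (\<forall>e\<in>\<Union>(set Ts). Y e) \<and> (\<forall>e\<in>D Ts. \<not> Y e)}"
  have finL: "finite L" unfolding L_def using fin by (intro finite_lists_length_eq) auto
  then have finR: "finite R" by (simp add: R_def)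
  have "A \<subseteq> (\<Union>Ts\<in>R. ?ev Ts)"
  proof
    fix Y assume "Y \<in> A"
    from cover[OF this] obtain Ts where Ts: "length Ts = k"
      "\<forall>T\<in>set Ts. T \<subseteq> V \<and> real (card T) \<le> t \<and> (\<forall>e\<in>T. Y e)"
      "D Ts \<subseteq> V" "d \<le> real (card (D Ts))" "\<forall>e\<in>D Ts. \<not> Y e" by blast
    then have "Ts \<in> R" by (auto simp: R_def L_def)
    then show "Y \<in> (\<Union>Ts\<in>R. ?ev Ts)" using Ts by blast
  qed
  then have "?P A \<le> ?P (\<Union>Ts\<in>R. ?ev Ts)" by (intro measure_pmf.finite_measure_mono) auto
  also have "\<dots> \<le> (\<Sum>Ts\<in>R. ?P (?ev Ts))"
    using finR by (intro measure_pmf.finite_measure_subadditive_finite) auto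
  also have "\<dots> \<le> (\<Sum>Ts\<in>R. exp (- (p * d)) * y powr (- (real k * t)) * (p * y) ^ card (\<Union>(set Ts)))"
  proof (rule sum_mono)
    fix Ts assume Ts: "Ts \<in> R"
    let ?U = "\<Union>(set Ts)"
    have sub: "?U \<subseteq> V" "D Ts \<subseteq> V" using Ts by (auto simp: R_def L_def)
    have "real (card ?U) \<le> (\<Sum>T\<in>set Ts. real (card T))"
      using card_UN_le[of "set Ts" "\<lambda>T. T"] by (simp add: of_nat_sum[symmetric] del: of_nat_sum)
    also have "\<dots> \<le> (\<Sum>T\<in>set Ts. t)" using Ts by (intro sum_mono) (auto simp: R_def)
    also have "\<dots> \<le> real k * t"
    \<comment> \<open>The list may repeat sets, so \<open>card (set Ts)\<close> is only at most
      \<open>k\<close> and \<open>0 \<le> t\<close> is needed. A member of the list supplies it; for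
      the empty list \<open>k = 0\<close>.\<close>
    proof (cases "Ts = []")
      case True
      then show ?thesis using Ts by (simp add: R_def L_def)
    next
      case False
      then have "0 \<le> t" using Ts by (auto simp: R_def neq_Nil_conv intro: order_trans[OF of_nat_0_le_iff])
      moreover have "card (set Ts) \<le> k" using Ts card_length by (auto simp: R_def L_def)
      ultimately show ?thesis by (simp add: mult_right_mono)
    qed
    finally have cU: "real (card ?U) \<le> real k * t" .
    have "(1 - p) ^ card (D Ts) \<le> exp (- p) ^ card (D Ts)"
      using exp_ge_add_one_self[of "- p"] p by (intro power_mono) auto
    also have "\<dots> = exp (- (p * real (card (D Ts))))" by (simp add: exp_of_nat_mult[symmetric] mult.commute)
    also have "\<dots> \<le> exp (- (p * d))" using Ts p by (auto simp: R_def intro: mult_left_mono)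
    finally have a: "(1 - p) ^ card (D Ts) \<le> exp (- (p * d))" .
    have "1 \<le> y powr (- (real k * t)) * y powr real (card ?U)"
    proof -
      have "y powr 0 \<le> y powr (real (card ?U) - real k * t)"
        using y cU by (intro powr_mono') auto
      then show ?thesis using y by (simp add: powr_add[symmetric] add.commute)
    qed
    then have b: "1 \<le> y powr (- (real k * t)) * y ^ card ?U" using y by (simp add: powr_realpow)
    have "?P (?ev Ts) \<le> p ^ card ?U * (1 - p) ^ card (D Ts)"
      by (rule prob_contains_avoids[OF fin p sub])
    also have "\<dots> \<le> p ^ card ?U * exp (- (p * d))" using a p by (intro mult_left_mono) auto
    also have "\<dots> = exp (- (p * d)) * p ^ card ?U * 1" by simp
    also have "\<dots> \<le> exp (- (p * d)) * p ^ card ?U * (y powr (- (real k * t)) * y ^ card ?U)"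
      using b p by (intro mult_left_mono) auto
    finally show "?P (?ev Ts) \<le> exp (- (p * d)) * y powr (- (real k * t)) * (p * y) ^ card ?U"
      by (simp add: power_mult_distrib mult_ac)
  qed
  also have "\<dots> = exp (- (p * d)) * y powr (- (real k * t)) * (\<Sum>Ts\<in>R. (p * y) ^ card (\<Union>(set Ts)))"
    by (simp add: sum_distrib_left)
  also have "\<dots> \<le> exp (- (p * d)) * y powr (- (real k * t)) * exp (2 ^ k * (p * y) * real (card V))"
  proof (rule mult_left_mono)
    have "(\<Sum>Ts\<in>R. (p * y) ^ card (\<Union>(set Ts))) \<le> (\<Sum>Ts\<in>L. (p * y) ^ card (\<Union>(set Ts)))"
      using finL p y by (intro sum_mono2) (auto simp: R_def)
    also have "\<dots> \<le> (1 + 2 ^ k * (p * y)) ^ card V"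
      unfolding L_def by (rule sum_lists_union_le[OF fin]) (use p y in auto)
    also have "\<dots> \<le> exp (2 ^ k * (p * y)) ^ card V"
      using p y by (intro power_mono) auto
    also have "\<dots> = exp (2 ^ k * (p * y) * real (card V))"
      by (simp add: exp_of_nat_mult[symmetric] mult.commute)
    finally show "(\<Sum>Ts\<in>R. (p * y) ^ card (\<Union>(set Ts))) \<le> exp (2 ^ k * (p * y) * real (card V))" .
  qed simp
  finally show ?thesis .
qed

subsection \<open>Supersaturation\<close>

lemma card_nsets_containing:
  assumes "finite A" "S \<subseteq> A" "card S \<le> r"
  shows "card {R \<in> nsets A r. S \<subseteq> R} = (card A - card S) choose (r - card S)"
proof -
  have finS: "finite S" using assms finite_subset by blast
  have "bij_betw (\<lambda>Q. Q \<union> S) (nsets (A - S) (r - card S)) {R \<in> nsets A r. S \<subseteq> R}"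
  proof (rule bij_betwI[where g = "\<lambda>R. R - S"])
    show "(\<lambda>Q. Q \<union> S) \<in> nsets (A - S) (r - card S) \<rightarrow> {R \<in> nsets A r. S \<subseteq> R}"
    proof
      fix Q assume Q: "Q \<in> nsets (A - S) (r - card S)"
      then have "card (Q \<union> S) = card Q + card S"
        using finS by (intro card_Un_disjoint) (auto simp: nsets_def)
      with Q show "Q \<union> S \<in> {R \<in> nsets A r. S \<subseteq> R}"
        using assms finS by (auto simp: nsets_def)
    qed
    show "(\<lambda>R. R - S) \<in> {R \<in> nsets A r. S \<subseteq> R} \<rightarrow> nsets (A - S) (r - card S)"
      using finS by (auto simp: nsets_def card_Diff_subset)
  qed (auto simp: nsets_def)
  then have "card {R \<in> nsets A r. S \<subseteq> R} = card (nsets (A - S) (r - card S))"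
    using bij_betw_same_card by fastforce
  also have "\<dots> = (card A - card S) choose (r - card S)"
    using assms finS by (simp add: card_Diff_subset)
  finally show ?thesis .
qed

lemma card_covered_nsets_le:
  assumes "finite A" "M \<subseteq> nsets A h" "h \<le> r"
  shows "card {R \<in> nsets A r. \<exists>S\<in>M. S \<subseteq> R} \<le> card M * ((card A - h) choose (r - h))"
proof -
  have finM: "finite M" using assms finite_subset finite_imp_finite_nsets by metis
  have eq: "{R \<in> nsets A r. \<exists>S\<in>M. S \<subseteq> R} = (\<Union>S\<in>M. {R \<in> nsets A r. S \<subseteq> R})" by auto
  have "card {R \<in> nsets A r. \<exists>S\<in>M. S \<subseteq> R} \<le> (\<Sum>S\<in>M. card {R \<in> nsets A r. S \<subseteq> R})"
    unfolding eq by (rule card_UN_le[OF finM])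
  also have "\<dots> = (\<Sum>S\<in>M. (card A - h) choose (r - h))"
  proof (rule sum.cong)
    fix S assume "S \<in> M"
    then have "S \<subseteq> A" "card S = h" using assms by (auto simp: nsets_def)
    then show "card {R \<in> nsets A r. S \<subseteq> R} = (card A - h) choose (r - h)"
      using card_nsets_containing[of A S r] assms by simp
  qed simp
  finally show ?thesis by simp
qed

text \<open>By Ramsey's theorem every \<open>r\<close>-subset of \<open>A\<close> contains a pair
  outside \<open>C1 \<union> C2\<close> or an \<open>h\<close>-set with all pairs in
  \<open>C1\<close> or all in \<open>C2\<close>. The choice of \<epsilon> lets the
  \<open>h\<close>-sets account for at most half of the \<open>r\<close>-subsets, so the outside
  pairs must cover the other half.\<close>

lemma ramsey_supersaturation:
  "\<exists>(r :: nat) (\<epsilon> :: real) (\<delta> :: real). 0 < \<epsilon> \<and> 0 < \<delta> \<and> \<delta> \<le> 1 \<and>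
     (\<forall>(A :: 'a set) C1 C2. finite A \<longrightarrow> r \<le> card A \<longrightarrow>
        real (card {S \<in> nsets A h. nsets S 2 \<subseteq> C1}) \<le> \<epsilon> * real (card A choose h) \<longrightarrow>
        real (card {S \<in> nsets A h. nsets S 2 \<subseteq> C2}) \<le> \<epsilon> * real (card A choose h) \<longrightarrow>
        \<delta> * real (card (nsets A 2)) \<le> real (card (nsets A 2 - (C1 \<union> C2))))"
proof -
  obtain r0 where r0: "\<And>(V :: 'a set) E. finite V \<Longrightarrow> r0 \<le> card V \<Longrightarrow>
      \<exists>R\<subseteq>V. card R = h \<and> clique R E \<or> card R = h \<and> indep R E"
    using ramsey2[of h h, where 'a = 'a] by blast
  define r where "r = max r0 (max h 2)"
  have r: "r0 \<le> r" "h \<le> r" "2 \<le> r" by (auto simp: r_def)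
  define \<epsilon> :: real where "\<epsilon> = 1 / (4 * real (r choose h))"
  define \<delta> :: real where "\<delta> = 1 / (2 * real (r choose 2))"
  have rh: "1 \<le> r choose h" "1 \<le> r choose 2" using r by (simp_all add: Suc_le_eq)
  have main: "\<delta> * real (card (nsets A 2)) \<le> real (card (nsets A 2 - (C1 \<union> C2)))"
    if fin: "finite A" and n: "r \<le> card A"
      and C1: "real (card {S \<in> nsets A h. nsets S 2 \<subseteq> C1}) \<le> \<epsilon> * real (card A choose h)"
      and C2: "real (card {S \<in> nsets A h. nsets S 2 \<subseteq> C2}) \<le> \<epsilon> * real (card A choose h)"
    for A :: "'a set" and C1 C2
  proof -
    let ?n = "card A" and ?D = "nsets A 2 - (C1 \<union> C2)"
    let ?M = "\<lambda>C. {S \<in> nsets A h. nsets S 2 \<subseteq> C}"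
    let ?T = "\<lambda>M. {R \<in> nsets A r. \<exists>S\<in>M. S \<subseteq> R}"
    have "nsets A r \<subseteq> ?T ?D \<union> (?T (?M C1) \<union> ?T (?M C2))"
    proof
      fix R assume R: "R \<in> nsets A r"
      then have "finite R" "card R = r" "R \<subseteq> A" by (auto simp: nsets_def)
      then obtain S where S: "S \<subseteq> R" "card S = h" "clique S C1 \<or> indep S C1"
        using r0[of R C1] r by blast
      have SA: "S \<in> nsets A h" using S R finite_subset by (auto simp: nsets_def)
      show "R \<in> ?T ?D \<union> (?T (?M C1) \<union> ?T (?M C2))"
      proof (cases "nsets R 2 \<subseteq> C1 \<union> C2")
        case False
        then obtain e where "e \<in> nsets R 2" "e \<notin> C1 \<union> C2" by blast
        then have "e \<in> ?D" "e \<subseteq> R" using \<open>R \<subseteq> A\<close> by (auto simp: nsets_def)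
        then show ?thesis using R by blast
      next
        case True
        have "nsets S 2 \<subseteq> C1 \<or> nsets S 2 \<subseteq> C2"
          using S(3)
        proof
          assume "clique S C1"
          then show ?thesis by (auto simp: clique_def elim!: nsets2_E)
        next
          assume i: "indep S C1"
          have "e \<in> C2" if e: "e \<in> nsets S 2" for e
          proof -
            obtain x y where "e = {x, y}" "x \<in> S" "y \<in> S" "x \<noteq> y" using e by (rule nsets2_E)
            then have "e \<notin> C1" using i by (auto simp: indep_def)
            then show ?thesis using e True nsets_mono[OF S(1), of 2] by blast
          qed
          then show ?thesis by blast
        qed
        then show ?thesis using SA S(1) R by blast
      qed
    qed
    then have "card (nsets A r) \<le> card (?T ?D \<union> (?T (?M C1) \<union> ?T (?M C2)))"
      by (rule card_mono[rotated]) (use fin finite_imp_finite_nsets[OF fin, of r] in auto)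
    also have "\<dots> \<le> card (?T ?D) + (card (?T (?M C1)) + card (?T (?M C2)))"
      by (meson add_left_mono card_Un_le order_trans)
    also have "\<dots> \<le> card ?D * ((?n - 2) choose (r - 2))
        + (card (?M C1) * ((?n - h) choose (r - h)) + card (?M C2) * ((?n - h) choose (r - h)))"
      by (intro add_mono card_covered_nsets_le fin r) auto
    finally have "?n choose r \<le> card ?D * ((?n - 2) choose (r - 2))
        + (card (?M C1) * ((?n - h) choose (r - h)) + card (?M C2) * ((?n - h) choose (r - h)))"
      by simp
    then have "real (?n choose r) \<le> real (card ?D) * real ((?n - 2) choose (r - 2))
        + (real (card (?M C1)) * real ((?n - h) choose (r - h))
            + real (card (?M C2)) * real ((?n - h) choose (r - h)))"
      by (simp only: of_nat_add[symmetric] of_nat_mult[symmetric] of_nat_le_iff)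
    also have "\<dots> \<le> real (card ?D) * real ((?n - 2) choose (r - 2))
        + (\<epsilon> * real (?n choose h) * real ((?n - h) choose (r - h))
            + \<epsilon> * real (?n choose h) * real ((?n - h) choose (r - h)))"
      using C1 C2 by (intro add_left_mono add_mono mult_right_mono) auto
    also have "\<epsilon> * real (?n choose h) * real ((?n - h) choose (r - h)) = real (?n choose r) / 4"
    proof -
      \<comment> \<open>Counting pairs of an \<open>r\<close>-set and an \<open>h\<close>-set inside
        it shows that each class covers at most a quarter of the \<open>r\<close>-sets.\<close>
      have "(?n choose r) * (r choose h) = (?n choose h) * ((?n - h) choose (r - h))"
        using r n by (intro choose_mult) auto
      then have "real (?n choose h) * real ((?n - h) choose (r - h)) = real (?n choose r) * real (r choose h)"
        by (metis of_nat_mult)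
      then show ?thesis using rh r by (simp add: \<epsilon>_def field_simps)
    qed
    finally have "real (?n choose r) / 2 \<le> real (card ?D) * real ((?n - 2) choose (r - 2))" by simp
    from mult_left_mono[OF this, of "real (?n choose 2)"]
    have "real (?n choose 2) * (real (?n choose r) / 2)
        \<le> real (card ?D) * (real (?n choose 2) * real ((?n - 2) choose (r - 2)))"
      by (simp only: mult.left_commute of_nat_0_le_iff)
    also have "real (?n choose 2) * real ((?n - 2) choose (r - 2)) = real (?n choose r) * real (r choose 2)"
      using choose_mult[of 2 r ?n] r n by (simp only: of_nat_mult[symmetric] of_nat_le_iff)
    finally have "real (?n choose r) * real (?n choose 2) \<le> real (?n choose r) * (2 * real (r choose 2) * real (card ?D))"
      by (simp add: mult_ac)
    moreover have "0 < real (?n choose r)" using n by simp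
    ultimately have "real (?n choose 2) \<le> 2 * real (r choose 2) * real (card ?D)"
      by (simp only: mult_le_cancel_left_pos)
    then show ?thesis using rh r by (simp add: \<delta>_def field_simps)
  qed
  have pos: "0 < \<epsilon>" "0 < \<delta>" "\<delta> \<le> 1"
  proof -
    have "1 \<le> real (r choose h)" "1 \<le> real (r choose 2)" using rh by linarith+
    then have "0 < real (r choose h)" "0 < real (r choose 2)" "1 \<le> 2 * real (r choose 2)" by linarith+
    then show "0 < \<epsilon>" "0 < \<delta>" "\<delta> \<le> 1"
      unfolding \<epsilon>_def \<delta>_def by (auto simp only: zero_less_divide_iff divide_le_eq_1)
  qed
  show ?thesis
    by (intro exI[of _ r] exI[of _ \<epsilon>] exI[of _ \<delta>] conjI allI impI; (rule pos | (rule main; assumption)))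
qed

section \<open>Order isomorphisms from finite linear orders to sets of naturals\<close>

lemma ordered_graph_enumeration:
  fixes S :: "nat set"
  assumes "finite A" "linear_order_on A r" "finite S" "card S = card A"
  shows "\<exists>g. bij_betw g A S \<and> (\<forall>x\<in>A. \<forall>y\<in>A. (x, y) \<in> r \<longleftrightarrow> g x \<le> g y)"
proof -
  have tr: "trans r" and anti: "antisym r" and tot: "total_on A r" and refl: "refl_on A r"
    using assms(2) by (auto simp: linear_order_on_def partial_order_on_def preorder_on_def)
  \<comment> \<open>The number of strict predecessors maps \<open>A\<close> isomorphically onto an
    initial segment of the naturals, which is then mapped increasingly onto
    \<open>S\<close>.\<close>
  define rank where "rank x = card {y\<in>A. (y, x) \<in> r \<and> y \<noteq> x}" for x
  have less: "rank x < rank y" if "x \<in> A" "y \<in> A" "(x, y) \<in> r" "x \<noteq> y" for x y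
    unfolding rank_def
  proof (rule psubset_card_mono)
    show "{z\<in>A. (z, x) \<in> r \<and> z \<noteq> x} \<subset> {z\<in>A. (z, y) \<in> r \<and> z \<noteq> y}"
    proof
      show "{z\<in>A. (z, x) \<in> r \<and> z \<noteq> x} \<subseteq> {z\<in>A. (z, y) \<in> r \<and> z \<noteq> y}"
        using that tr anti by (auto dest: transD antisymD)
      show "{z\<in>A. (z, x) \<in> r \<and> z \<noteq> x} \<noteq> {z\<in>A. (z, y) \<in> r \<and> z \<noteq> y}"
        using that by blast
    qed
  qed (use assms in auto)
  have iff: "(x, y) \<in> r \<longleftrightarrow> rank x \<le> rank y" if xy: "x \<in> A" "y \<in> A" for x y
  proof (cases "x = y")
    case True
    then show ?thesis using refl that by (simp add: refl_onD)
  next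
    case False
    then consider "(x, y) \<in> r" | "(y, x) \<in> r" "(x, y) \<notin> r"
      using tot xy False unfolding total_on_def by blast
    then show ?thesis
    proof cases
      case 1
      then show ?thesis using less[OF that] False by simp
    next
      case 2
      then show ?thesis using less[OF that(2,1)] False by simp
    qed
  qed
  have inj: "inj_on rank A"
  proof (rule inj_onI)
    fix x y assume "x \<in> A" "y \<in> A" "rank x = rank y"
    then show "x = y" using iff[of x y] iff[of y x] anti by (auto dest: antisymD)
  qed
  have "rank ` A \<subseteq> {..<card A}"
  proof
    fix i assume "i \<in> rank ` A"
    then obtain x where x: "x \<in> A" "i = rank x" by blast
    then have "rank x < card A"
      unfolding rank_def using assms(1) by (intro psubset_card_mono) auto
    with x show "i \<in> {..<card A}" by simp
  qed
  then have "rank ` A = {..<card A}"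
    using card_image[OF inj] by (intro card_subset_eq) auto
  then have rank: "bij_betw rank A {..<card S}" using inj assms(4) by (simp add: bij_betw_def)
  obtain f where f: "bij_betw f {..<card S} S" "strict_mono_on {..<card S} f"
    using ex_bij_betw_strict_mono_card[OF assms(3)] by blast
  have "(x, y) \<in> r \<longleftrightarrow> (f \<circ> rank) x \<le> (f \<circ> rank) y" if "x \<in> A" "y \<in> A" for x y
  proof -
    have "rank x \<in> {..<card S}" "rank y \<in> {..<card S}" using rank that by (auto simp: bij_betw_def)
    then have "f (rank x) \<le> f (rank y) \<longleftrightarrow> rank x \<le> rank y"
      using strict_mono_on_less_eq[OF f(2)] by blast
    then show ?thesis using iff[OF that] by simp
  qed
  then show ?thesis using bij_betw_trans[OF rank f(1)] by blast
qed

subsection \<open>Ordered copies in the random graph\<close>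

definition enumeration :: "'a ograph \<Rightarrow> nat set \<Rightarrow> 'a \<Rightarrow> nat" where
  "enumeration H S = (SOME g. bij_betw g (verts H) S \<and>
     (\<forall>x\<in>verts H. \<forall>y\<in>verts H. (x, y) \<in> vorder H \<longleftrightarrow> g x \<le> g y))"

text \<open>The order isomorphism onto \<open>S\<close> is unique, so \<open>S\<close> carries
  exactly one copy of \<open>H\<close> in the complete graph and copies can be indexed by vertex
  sets. If \<open>H\<close> has isolated vertices, different \<open>S\<close> may give the same edge
  set; the indexing counts them separately.\<close>

definition copy_edges :: "'a ograph \<Rightarrow> nat set \<Rightarrow> nat set set" where
  "copy_edges H S = (\<lambda>e. enumeration H S ` e) ` edges H"

lemma enumeration:
  assumes "ordered_graph H" "finite S" "card S = card (verts H)"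
  shows "bij_betw (enumeration H S) (verts H) S"
    and "x \<in> verts H \<Longrightarrow> y \<in> verts H \<Longrightarrow>
           (x, y) \<in> vorder H \<longleftrightarrow> enumeration H S x \<le> enumeration H S y"
proof -
  have "\<exists>g. bij_betw g (verts H) S \<and>
     (\<forall>x\<in>verts H. \<forall>y\<in>verts H. (x, y) \<in> vorder H \<longleftrightarrow> g x \<le> g y)"
    using assms by (intro ordered_graph_enumeration) (auto simp: ordered_graph_def simple_graph_def)
  from someI_ex[OF this, folded enumeration_def]
  show "bij_betw (enumeration H S) (verts H) S"
    and "x \<in> verts H \<Longrightarrow> y \<in> verts H \<Longrightarrow>
           (x, y) \<in> vorder H \<longleftrightarrow> enumeration H S x \<le> enumeration H S y"
    by blast+
qed

lemma vertex_pairs_eq_nsets: "vertex_pairs n = nsets {1..n} 2"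
  by (auto simp: vertex_pairs_def nsets_def finite_subset)

lemma simple_graph_edges:
  assumes "simple_graph G"
  shows "edges G \<subseteq> nsets (verts G) 2" "finite (edges G)"
proof -
  show *: "edges G \<subseteq> nsets (verts G) 2"
    using assms by (auto simp: simple_graph_def nsets_def intro: finite_subset)
  then show "finite (edges G)"
    using assms by (auto simp: simple_graph_def intro: finite_subset finite_imp_finite_nsets)
qed

lemma copy_edges:
  assumes H: "ordered_graph H" and S: "finite S" "card S = card (verts H)"
  shows "copy_edges H S \<subseteq> nsets S 2" "card (copy_edges H S) = card (edges H)"
    "inj_on (\<lambda>e. enumeration H S ` e) (Pow (verts H))"
proof -
  have bij: "bij_betw (enumeration H S) (verts H) S" by (rule enumeration(1)[OF H S])
  then have inj: "inj_on (enumeration H S) (verts H)" by (simp add: bij_betw_def)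
  then show inj2: "inj_on (\<lambda>e. enumeration H S ` e) (Pow (verts H))" by (rule inj_on_image_Pow)
  have eH: "edges H \<subseteq> nsets (verts H) 2" using H by (simp add: ordered_graph_def simple_graph_edges)
  then have "edges H \<subseteq> Pow (verts H)" by (auto simp: nsets_def)
  then show "card (copy_edges H S) = card (edges H)"
    unfolding copy_edges_def using inj_on_subset[OF inj2] by (intro card_image) auto
  show "copy_edges H S \<subseteq> nsets S 2"
  proof
    fix f assume "f \<in> copy_edges H S"
    then obtain e where e: "e \<in> edges H" "f = enumeration H S ` e" by (auto simp: copy_edges_def)
    then have "e \<subseteq> verts H" "finite e" "card e = 2" using eH by (auto simp: nsets_def)
    then show "f \<in> nsets S 2"
      using e bij card_image[OF inj_on_subset[OF inj]] by (auto simp: nsets_def bij_betw_def)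
  qed
qed

lemma ordered_copy_of_copy_edges:
  assumes H: "ordered_graph H" and S: "S \<subseteq> {1..n}" "card S = card (verts H)"
    and F: "copy_edges H S \<subseteq> F"
  shows "ordered_copy \<lparr>verts = S, edges = copy_edges H S, vorder = {(x, y). x \<in> S \<and> y \<in> S \<and> x \<le> y}\<rparr>
           H (naturally_ordered \<lparr>verts = {1..n}, edges = F\<rparr>)"
    (is "ordered_copy ?C H ?F")
proof -
  have finS: "finite S" using S finite_subset by blast
  note ce = copy_edges[OF H finS S(2)] and en = enumeration[OF H finS S(2)]
  have "simple_graph ?C" using ce(1) finS by (auto simp: simple_graph_def nsets_def)
  then have sub: "ordered_subgraph ?C ?F"
    using S F by (auto simp: ordered_subgraph_def subgraph_def naturally_ordered_def)
  define f where "f = inv_into (verts H) (enumeration H S)"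
  have bf: "bij_betw f S (verts H)" unfolding f_def by (rule bij_betw_inv_into[OF en(1)])
  have inj: "inj_on (enumeration H S) (verts H)" using en(1) by (simp add: bij_betw_def)
  have eH: "\<And>e. e \<in> edges H \<Longrightarrow> e \<subseteq> verts H" using H by (auto simp: ordered_graph_def simple_graph_def)
  have "f ` enumeration H S ` e = e" if "e \<in> edges H" for e
    unfolding f_def by (rule inv_into_image_cancel[OF inj eH[OF that]])
  then have "edges H = (\<lambda>e. f ` e) ` copy_edges H S"
    by (simp add: copy_edges_def image_image)
  moreover have "(f x, f y) \<in> vorder H \<longleftrightarrow> x \<le> y" if xy: "x \<in> S" "y \<in> S" for x y
  proof -
    have "f x \<in> verts H" "f y \<in> verts H" using bf xy by (auto simp: bij_betw_def)
    moreover have "enumeration H S (f x) = x" "enumeration H S (f y) = y"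
      using en(1) xy by (auto simp: f_def bij_betw_def f_inv_into_f)
    ultimately show ?thesis using en(2)[of "f x" "f y"] by simp
  qed
  ultimately have "ordered_graph_iso f ?C H"
    using bf by (auto simp: ordered_graph_iso_def graph_iso_def)
  then show ?thesis using sub by (auto simp: ordered_copy_def)
qed

section \<open>The 2-density and the degrees of the hypergraph of copies\<close>

lemma two_density_ge:
  fixes H :: "'a ograph" and G' :: "'a graph"
  assumes "simple_graph H" "subgraph G' H" "3 \<le> card (verts G')" "1 \<le> card (edges G')"
  shows "(real (card (edges G')) - 1) / (real (card (verts G')) - 2) \<le> two_density H"
proof -
  \<comment> \<open>Each quotient depends only on the vertex set and the edge set, so the maximum is
    over a finite set.\<close>
  let ?f = "\<lambda>(A, B). (real (card B) - 1) / (real (card A) - 2)"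
  have "{(real (card (edges G')) - 1) / (real (card (verts G')) - 2) | G' :: 'a graph.
            subgraph G' H \<and> card (verts G') \<ge> 3 \<and> card (edges G') \<ge> 1}
        \<subseteq> ?f ` (Pow (verts H) \<times> Pow (edges H))"
    by (auto simp: subgraph_def image_iff Bex_def)
  moreover have "finite (?f ` (Pow (verts H) \<times> Pow (edges H)))"
    using assms(1) simple_graph_edges(2) by (auto simp: simple_graph_def)
  ultimately show ?thesis
    unfolding two_density_def using assms finite_subset by (intro Max_ge) auto
qed

text \<open>A copy of \<open>P3\<close> has three vertices and two edges and contributes (2 - 1)/(3
  - 2) = 1 to the 2-density.\<close>

lemma not_partial_matching:
  fixes H :: "'a ograph"
  assumes "ordered_graph H" "\<not> partial_matching H"
  shows "3 \<le> card (verts H)" "0 < card (edges H)" "1 \<le> two_density H"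
proof -
  obtain P :: "'a graph" and f where P: "subgraph P H" "graph_iso f P P3"
    using assms(2) by (auto simp: partial_matching_def)
  have sH: "simple_graph H" using assms(1) by (simp add: ordered_graph_def)
  have bij: "bij_betw f (verts P) {0, 1, 2}"
    and e: "(\<lambda>e. f ` e) ` edges P = {{0, 1}, {1, 2}}"
    using P(2) by (auto simp: graph_iso_def P3_def)
  have v: "card (verts P) = 3" using bij_betw_same_card[OF bij] by simp
  have sub: "edges P \<subseteq> Pow (verts P)" using P(1) by (auto simp: subgraph_def simple_graph_def)
  have "inj_on (\<lambda>e. f ` e) (edges P)"
    using inj_on_image_Pow[of f "verts P"] bij inj_on_subset[OF _ sub] by (auto simp: bij_betw_def)
  from card_image[OF this] have "card (edges P) = card {{0, 1}, {1, 2 :: nat}}" using e by simp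
  also have "\<dots> = 2" by (auto simp: card_insert_if doubleton_eq_iff)
  finally have ec: "card (edges P) = 2" .
  have "finite (verts H)" using sH by (simp add: simple_graph_def)
  then show "3 \<le> card (verts H)" using v P(1) card_mono by (metis subgraph_def)
  have "2 \<le> card (edges H)"
    using ec P(1) card_mono[OF simple_graph_edges(2)[OF sH]] by (metis subgraph_def)
  then show "0 < card (edges H)" by simp
  show "1 \<le> two_density H" using two_density_ge[OF sH P(1)] v ec by simp
qed

text \<open>This is the only place where the exponent \<open>1 / m\<^sub>2(H)\<close> matters: a set \<open>L\<close> of pairs contained in a
  copy of \<open>H\<close> is a copy of a subgraph of \<open>H\<close>.\<close>

lemma spread_copy_edges:
  fixes H :: "'a ograph"
  assumes H: "ordered_graph H" and h: "3 \<le> card (verts H)" and d: "1 \<le> two_density H"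
    and n: "1 \<le> n" and p: "p = real n powr (- 1 / two_density H)"
  shows "spread (nsets {1..n} (card (verts H))) (copy_edges H) (real n ^ (card (verts H) - 2) / p) p"
  unfolding spread_def
proof (intro allI impI)
  fix L :: "nat set set" assume L: "finite L" "L \<noteq> {}"
  let ?h = "card (verts H)" and ?m = "two_density H"
  let ?X = "nsets {1..n} ?h"
  have p0: "0 < p" using n p by simp
  show "real (deg ?X (copy_edges H) L) \<le> real n ^ (?h - 2) / p * p ^ card L"
  proof (cases "\<exists>S\<in>?X. L \<subseteq> copy_edges H S")
    case False
    then have "{S\<in>?X. L \<subseteq> copy_edges H S} = {}" by blast
    then have "deg ?X (copy_edges H) L = 0" by (simp only: deg_def card.empty)
    then show ?thesis using p0 by simp
  next
    case True
    then obtain S where S: "S \<subseteq> {1..n}" "finite S" "card S = ?h" "L \<subseteq> copy_edges H S"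
      by (auto simp: nsets_def)
    note ce = copy_edges[OF H S(2,3)] and en = enumeration(1)[OF H S(2,3)]
    define W where "W = \<Union>L"
    have WS: "W \<subseteq> S" and L2: "L \<subseteq> nsets W 2" using S(4) ce(1) by (auto simp: W_def nsets_def)
    have finW: "finite W" using WS S(2) finite_subset by blast
    have Wh: "card W \<le> ?h" using WS S by (metis card_mono)
    have hn: "?h \<le> n" using S card_mono[of "{1..n}" S] by simp
    have W2: "2 \<le> card W"
    proof -
      obtain e where "e \<in> L" using L by blast
      then have "e \<subseteq> W" "card e = 2" using L2 by (auto simp: nsets_def)
      then show ?thesis using finW card_mono by metis
    qed
    \<comment> \<open>A copy containing \<open>L\<close> has all of \<open>W\<close> among its
      vertices, leaving at most \<open>n ^ (card (verts H) - card W)\<close> choices.\<close>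
    have "deg ?X (copy_edges H) L \<le> card {T\<in>?X. W \<subseteq> T}"
      unfolding deg_def
    proof (rule card_mono)
      show "{T \<in> ?X. L \<subseteq> copy_edges H T} \<subseteq> {T\<in>?X. W \<subseteq> T}"
        using copy_edges(1)[OF H] by (fastforce simp: W_def nsets_def)
    qed (simp add: finite_imp_finite_nsets)
    also have "\<dots> = (n - card W) choose (?h - card W)"
      using card_nsets_containing[of "{1..n}" W ?h] WS S(1) Wh by simp
    also have "\<dots> \<le> (n - card W) ^ (?h - card W)" using hn by (intro binomial_le_pow) simp
    also have "\<dots> \<le> n ^ (?h - card W)" by (intro power_mono) auto
    finally have "real (deg ?X (copy_edges H) L) \<le> real n ^ (?h - card W)"
      by (metis of_nat_le_iff of_nat_power)
    also have "\<dots> \<le> real n ^ (?h - 2) * p ^ (card L - 1)"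
    \<comment> \<open>Two vertices carry a single pair, and the bound is an equality. The 2-density
      speaks of at least three vertices and enters only in the other case.\<close>
    proof (cases "card W = 2")
      case True
      then have "nsets W 2 = {W}" using finW by (auto simp: nsets_def dest: card_subset_eq)
      then have "L = {W}" using L L2 by auto
      then show ?thesis using True by simp
    next
      case False
      let ?g = "enumeration H S"
      define G' :: "'a graph" where
        "G' = \<lparr>verts = {x\<in>verts H. ?g x \<in> W}, edges = {e\<in>edges H. ?g ` e \<in> L}\<rparr>"
      have eH: "\<And>e. e \<in> edges H \<Longrightarrow> e \<subseteq> verts H" and finH: "finite (verts H)"
        using H by (auto simp: ordered_graph_def simple_graph_def)
      have "?g ` verts G' = W" using en WS by (auto simp: G'_def bij_betw_def)
      moreover have "inj_on ?g (verts G')" using en by (auto simp: G'_def bij_betw_def inj_on_def)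
      ultimately have vG: "card (verts G') = card W" using card_image by metis
      have "(\<lambda>e. ?g ` e) ` edges G' = L" using S(4) by (auto simp: G'_def copy_edges_def)
      moreover have "inj_on (\<lambda>e. ?g ` e) (edges G')"
        by (rule inj_on_subset[OF ce(3)]) (use eH in \<open>auto simp: G'_def\<close>)
      ultimately have eG: "card (edges G') = card L" using card_image by metis
      have "e \<subseteq> verts G' \<and> card e = 2" if "e \<in> edges G'" for e
      proof -
        have e: "e \<in> edges H" "?g ` e \<in> L" using that by (auto simp: G'_def)
        then have "?g ` e \<subseteq> W" unfolding W_def by blast
        then show ?thesis
          using e(1) H eH[OF e(1)] by (auto simp: G'_def ordered_graph_def simple_graph_def)
      qed
      then have "subgraph G' H"
        using finH by (auto simp: subgraph_def simple_graph_def G'_def)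
      moreover have cL: "1 \<le> card L" using L by (simp add: Suc_le_eq card_gt_0_iff)
      ultimately have "(real (card L) - 1) / (real (card W) - 2) \<le> ?m"
        using two_density_ge[of H G'] H vG eG False W2 by (simp add: ordered_graph_def)
      then have "real (card L) - 1 \<le> ?m * (real (card W) - 2)"
        using False W2 by (simp add: divide_le_eq)
      then have le: "(real (card L) - 1) / ?m \<le> real (card W) - 2"
        using d by (simp add: divide_le_eq mult.commute)
      have n0: "0 < real n" using n by simp
      have "real n ^ (?h - card W) = real n powr (real (?h - 2) - (real (card W) - 2))"
        using n0 Wh W2 by (simp add: powr_realpow[symmetric] of_nat_diff)
      also have "\<dots> \<le> real n powr (real (?h - 2) - (real (card L) - 1) / ?m)"
        using le n by (intro powr_mono) auto
      also have "\<dots> = real n powr real (?h - 2) * real n powr (- 1 / ?m * real (card L - 1))"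
        using cL by (simp add: powr_add[symmetric] of_nat_diff)
      also have "\<dots> = real n powr real (?h - 2) * p powr real (card L - 1)"
        unfolding p by (simp only: powr_powr)
      also have "\<dots> = real n ^ (?h - 2) * p ^ (card L - 1)"
        by (simp only: powr_realpow[OF n0] powr_realpow[OF p0])
      finally show ?thesis .
    qed
    also have "\<dots> = real n ^ (?h - 2) / p * p ^ card L"
    proof -
      have "card L = Suc (card L - 1)" using L by (simp add: card_gt_0_iff)
      then have "p ^ card L = p * p ^ (card L - 1)" by (metis power_Suc)
      then show ?thesis using p0 by simp
    qed
    finally show ?thesis .
  qed
qed

lemma multi_hypergraph_copy_edges:
  assumes "ordered_graph H"
  shows "multi_hypergraph (nsets {1..n} 2) (nsets {1..n} (card (verts H))) (copy_edges H) (card (edges H))"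
proof -
  have "copy_edges H S \<subseteq> nsets {1..n} 2 \<and> card (copy_edges H S) = card (edges H)"
    if "S \<in> nsets {1..n} (card (verts H))" for S
  proof -
    have "finite S" "card S = card (verts H)" "S \<subseteq> {1..n}" using that by (auto simp: nsets_def)
    then show ?thesis using copy_edges(1,2)[OF assms, of S] nsets_mono by blast
  qed
  then show ?thesis by (auto simp: multi_hypergraph_def finite_imp_finite_nsets)
qed

text \<open>Density of the hypergraph of copies: \<open>B * p * card V\<close> is at most
  \<open>n ^ h\<close>, while the number of copies is at least \<open>(n / h) ^ h\<close>.\<close>

lemma nsets_dense:
  assumes "0 < p" "2 \<le> h" "h \<le> n"
  shows "1 / real h ^ h * (real n ^ (h - 2) / p * p) * real (card (nsets {1..n} 2))
           \<le> real (card (nsets {1..n} h))"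
proof -
  have "real (n choose 2) \<le> real n ^ 2"
    using binomial_le_pow[of 2 n] assms by (metis le_trans of_nat_le_iff of_nat_power)
  then have "1 / real h ^ h * (real n ^ (h - 2) / p * p) * real (n choose 2)
      \<le> 1 / real h ^ h * real n ^ (h - 2) * real n ^ 2"
    using assms by (simp add: mult_left_mono divide_right_mono)
  also have "\<dots> = (real n / real h) ^ h"
  proof -
    have "h - 2 + 2 = h" using assms by simp
    then have "real n ^ (h - 2 + 2) = real n ^ h" by (simp only:)
    then have "real n ^ (h - 2) * real n ^ 2 = real n ^ h" by (simp only: power_add)
    then show ?thesis by (simp add: power_divide)
  qed
  also have "\<dots> \<le> real (n choose h)" using assms by (intro binomial_ge_n_over_k_pow_k)
  finally show ?thesis by simp
qed

section \<open>From containers of the colour classes to a probability bound\<close>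

lemma colour_class_edge_free:
  assumes H: "ordered_graph H"
    and mono: "\<And>H' k. ordered_copy H' H (naturally_ordered \<lparr>verts = {1..n}, edges = F\<rparr>) \<Longrightarrow>
                 \<not> (\<forall>e \<in> edges H'. col e = k)"
  shows "edge_free (nsets {1..n} (card (verts H))) (copy_edges H) {e \<in> F. col e = k}"
  unfolding edge_free_def
proof (intro ballI notI)
  fix S assume S: "S \<in> nsets {1..n} (card (verts H))" and sub: "copy_edges H S \<subseteq> {e \<in> F. col e = k}"
  then have "S \<subseteq> {1..n}" "card S = card (verts H)" "copy_edges H S \<subseteq> F"
    by (auto simp: nsets_def)
  from mono[OF ordered_copy_of_copy_edges[OF H this], of k] sub show False by auto
qed

text \<open>Containers bound copies of \<open>H\<close>, supersaturation asks about complete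
  subgraphs. A vertex set with all its pairs in \<open>C\<close> also has its copy of
  \<open>H\<close> there.\<close>

lemma card_nsets_pairs_inside_le:
  assumes "ordered_graph H" "real (card {S \<in> nsets {1..n} (card (verts H)). copy_edges H S \<subseteq> C}) \<le> t"
  shows "real (card {S \<in> nsets {1..n} (card (verts H)). nsets S 2 \<subseteq> C}) \<le> t"
proof -
  have "card {S \<in> nsets {1..n} (card (verts H)). nsets S 2 \<subseteq> C}
      \<le> card {S \<in> nsets {1..n} (card (verts H)). copy_edges H S \<subseteq> C}"
  proof (rule card_mono)
    have "copy_edges H S \<subseteq> nsets S 2" if "S \<in> nsets {1..n} (card (verts H))" for S
      using copy_edges(1)[OF assms(1)] that by (auto simp: nsets_def)
    then show "{S \<in> nsets {1..n} (card (verts H)). nsets S 2 \<subseteq> C}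
        \<subseteq> {S \<in> nsets {1..n} (card (verts H)). copy_edges H S \<subseteq> C}" by blast
  qed (simp add: finite_imp_finite_nsets)
  then show ?thesis using assms(2) by linarith
qed

lemma prob_not_ramsey_le:
  fixes H :: "'a ograph"
  assumes H: "ordered_graph H" and h: "3 \<le> card (verts H)" "0 < card (edges H)" "1 \<le> two_density H"
  shows "\<exists>n0 \<delta> \<kappa> k. 0 < \<delta> \<and> \<delta> \<le> 1 \<and> 0 < \<kappa> \<and> (\<forall>n\<ge>n0. \<forall>q y. 0 \<le> q \<longrightarrow> q \<le> 1 \<longrightarrow> 0 < y \<longrightarrow> y \<le> 1 \<longrightarrow>
     measure_pmf.prob (random_graph n q) {G. \<not> ordered_ramsey_graph (naturally_ordered G) H}
       \<le> exp (- (q * (\<delta> * real (n choose 2)))) *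
          y powr (- (real k * (\<kappa> * real n powr (- 1 / two_density H) * real (n choose 2)))) *
          exp (2 ^ k * (q * y) * real (n choose 2)))"
proof -
  let ?h = "card (verts H)" and ?s = "card (edges H)"
  obtain r \<epsilon> \<delta> where \<epsilon>: "0 < \<epsilon>" and \<delta>: "0 < \<delta>" "\<delta> \<le> 1" and super:
    "\<forall>(A :: nat set) C1 C2. finite A \<longrightarrow> r \<le> card A \<longrightarrow>
        real (card {S \<in> nsets A ?h. nsets S 2 \<subseteq> C1}) \<le> \<epsilon> * real (card A choose ?h) \<longrightarrow>
        real (card {S \<in> nsets A ?h. nsets S 2 \<subseteq> C2}) \<le> \<epsilon> * real (card A choose ?h) \<longrightarrow>
        \<delta> * real (card (nsets A 2)) \<le> real (card (nsets A 2 - (C1 \<union> C2)))"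
    using ramsey_supersaturation[of ?h, where 'a = nat] by (elim exE conjE) (rule that)
  have \<rho>: "0 < 1 / real ?h ^ ?h" using h by simp
  from containers[OF \<rho> \<epsilon> h(2)] obtain k \<kappa> where \<kappa>: "0 < \<kappa>" and cont:
    "\<forall>(V :: nat set set) (X :: nat set set) E p B.
        multi_hypergraph V X E ?s \<longrightarrow> spread X E B p \<longrightarrow> 0 < p \<longrightarrow> p \<le> 1 \<longrightarrow> 0 \<le> B \<longrightarrow>
        1 / real ?h ^ ?h * (B * p) * real (card V) \<le> real (card X) \<longrightarrow>
        (\<exists>C. \<forall>I\<subseteq>V. edge_free X E I \<longrightarrow>
           captured V k (\<kappa> * p * real (card V)) C
             (\<lambda>W. real (card {x\<in>X. E x \<subseteq> W}) \<le> \<epsilon> * real (card X)) I)"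
    by (elim exE conjE) (rule that)
  have main: "measure_pmf.prob (random_graph n q) {G. \<not> ordered_ramsey_graph (naturally_ordered G) H}
       \<le> exp (- (q * (\<delta> * real (n choose 2)))) *
          y powr (- (real (2 * k) * (\<kappa> * real n powr (- 1 / two_density H) * real (n choose 2)))) *
          exp (2 ^ (2 * k) * (q * y) * real (n choose 2))"
    if n: "max r ?h \<le> n" and q: "0 \<le> q" "q \<le> 1" and y: "0 < y" "y \<le> 1" for n q y
  proof -
    let ?V = "nsets {1..n} 2" and ?X = "nsets {1..n} ?h"
    \<comment> \<open>The container parameter sits at the threshold and is separate from the edge
      probability \<open>q\<close>.\<close>
    define p where "p = real n powr (- 1 / two_density H)"
    have n1: "1 \<le> n" using n h by simp
    have p: "0 < p" "p \<le> 1" using n1 h(3) powr_mono[of "- 1 / two_density H" 0 "real n"]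
      by (auto simp: p_def)
    have cV: "card ?V = n choose 2" by simp
    let ?few = "\<lambda>W. real (card {x\<in>?X. copy_edges H x \<subseteq> W}) \<le> \<epsilon> * real (card ?X)"
    have "\<exists>C. \<forall>I\<subseteq>?V. edge_free ?X (copy_edges H) I \<longrightarrow>
           captured ?V k (\<kappa> * p * real (card ?V)) C ?few I"
    proof (rule cont[rule_format])
      show "spread ?X (copy_edges H) (real n ^ (?h - 2) / p) p"
        by (rule spread_copy_edges[OF H h(1,3) n1 p_def])
      show "1 / real ?h ^ ?h * (real n ^ (?h - 2) / p * p) * real (card ?V) \<le> real (card ?X)"
        using n h by (intro nsets_dense p) auto
    qed (use p multi_hypergraph_copy_edges[OF H] in auto)
    then obtain C where C: "\<And>I. I \<subseteq> ?V \<Longrightarrow> edge_free ?X (copy_edges H) I \<Longrightarrow>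
           captured ?V k (\<kappa> * p * real (card ?V)) C ?few I" by blast
    \<comment> \<open>The first \<open>k\<close> fingerprints belong to the red class, the last
      \<open>k\<close> to the blue one; \<open>D\<close> is what both containers leave
      uncovered.\<close>
    define D where "D Ts = ?V - (C (take k Ts) \<union> C (drop k Ts))" for Ts
    let ?A = "{Y. \<not> ordered_ramsey_graph
                 (naturally_ordered \<lparr>verts = {1..n}, edges = {e \<in> vertex_pairs n. Y e}\<rparr>) H}"
    have "measure_pmf.prob (random_graph n q) {G. \<not> ordered_ramsey_graph (naturally_ordered G) H}
        = measure_pmf.prob (Pi_pmf ?V False (\<lambda>_. bernoulli_pmf q)) ?A"
      unfolding random_graph_def by (simp add: vimage_def vertex_pairs_eq_nsets)
    also have "\<dots> \<le> exp (- (q * (\<delta> * real (card ?V)))) *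
        y powr (- (real (2 * k) * (\<kappa> * p * real (card ?V)))) * exp (2 ^ (2 * k) * (q * y) * real (card ?V))"
    proof (rule prob_fingerprint_le[where D = D])
      fix Y assume "Y \<in> ?A"
      then obtain col :: "nat set \<Rightarrow> colour" where col: "\<And>H' k. ordered_copy H' H (naturally_ordered
            \<lparr>verts = {1..n}, edges = {e \<in> ?V. Y e}\<rparr>) \<Longrightarrow> \<not> (\<forall>e \<in> edges H'. col e = k)"
        unfolding ordered_ramsey_graph_def vertex_pairs_eq_nsets by blast
      let ?I = "\<lambda>c. {e \<in> {e \<in> ?V. Y e}. col e = c}"
      have cap: "captured ?V k (\<kappa> * p * real (card ?V)) C ?few (?I c)" for c
      proof (rule C)
        show "edge_free ?X (copy_edges H) (?I c)" by (rule colour_class_edge_free[OF H]) (rule col)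
      qed auto
      from cap[of Red] obtain Ts where Ts: "length Ts = k"
        "\<forall>T\<in>set Ts. T \<subseteq> ?I Red \<and> real (card T) \<le> \<kappa> * p * real (card ?V)"
        "?I Red \<subseteq> C Ts" "?few (C Ts)" unfolding captured_def by blast
      from cap[of Blue] obtain Us where Us: "length Us = k"
        "\<forall>T\<in>set Us. T \<subseteq> ?I Blue \<and> real (card T) \<le> \<kappa> * p * real (card ?V)"
        "?I Blue \<subseteq> C Us" "?few (C Us)" unfolding captured_def by blast
      have D: "D (Ts @ Us) = ?V - (C Ts \<union> C Us)" using Ts(1) by (simp add: D_def)
      have "\<delta> * real (card ?V) \<le> real (card (?V - (C Ts \<union> C Us)))"
        using n Ts(4) Us(4) by (intro super[rule_format] card_nsets_pairs_inside_le[OF H]) auto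
      \<comment> \<open>An edge of the random graph has a colour and so lies in the container of its
        class.\<close>
      moreover have "\<not> Y e" if "e \<in> ?V - (C Ts \<union> C Us)" for e
        using that Ts(3) Us(3) by (cases "col e") auto
      moreover have "\<forall>T\<in>set (Ts @ Us). T \<subseteq> ?V \<and> real (card T) \<le> \<kappa> * p * real (card ?V) \<and> (\<forall>e\<in>T. Y e)"
        using Ts(2) Us(2) by fastforce
      ultimately show "\<exists>Ts. length Ts = 2 * k \<and>
          (\<forall>T\<in>set Ts. T \<subseteq> ?V \<and> real (card T) \<le> \<kappa> * p * real (card ?V) \<and> (\<forall>e\<in>T. Y e)) \<and>
          D Ts \<subseteq> ?V \<and> \<delta> * real (card ?V) \<le> real (card (D Ts)) \<and> (\<forall>e\<in>D Ts. \<not> Y e)"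
        using Ts(1) Us(1) D by (intro exI[of _ "Ts @ Us"]) auto
    qed (use q y in \<open>auto simp: finite_imp_finite_nsets\<close>)
    finally show ?thesis unfolding cV p_def .
  qed
  show ?thesis
    by (intro exI[of _ "max r ?h"] exI[of _ \<delta>] exI[of _ \<kappa>] exI[of _ "2 * k"] conjI allI impI;
        (rule \<delta> \<kappa> | (rule main; assumption)))
qed

theorem theorem6:
  fixes H :: "'a ograph"
  assumes "ordered_graph H"
    and "\<not> partial_matching H"
  shows "\<exists>c :: real. \<forall>p :: nat \<Rightarrow> real.
    (\<forall>n. 0 \<le> p n \<and> p n \<le> 1) \<longrightarrow>
    (\<forall>\<^sub>F n in sequentially. p n > c * real n powr (- 1 / two_density H)) \<longrightarrow>
    (\<lambda>n. measure_pmf.prob (random_graph n (p n))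
           {G. ordered_ramsey_graph (naturally_ordered G) H}) \<longlonglongrightarrow> 1"
proof -
  note h = not_partial_matching[OF assms]
  let ?m = "two_density H"
  obtain n0 \<delta> \<kappa> k where \<delta>: "0 < \<delta>" "\<delta> \<le> 1" and \<kappa>: "0 < \<kappa>" and bound: "\<forall>n\<ge>n0. \<forall>q y. 0 \<le> q \<longrightarrow> q \<le> 1 \<longrightarrow> 0 < y \<longrightarrow> y \<le> 1 \<longrightarrow>
     measure_pmf.prob (random_graph n q) {G. \<not> ordered_ramsey_graph (naturally_ordered G) H}
       \<le> exp (- (q * (\<delta> * real (n choose 2)))) *
          y powr (- (real k * (\<kappa> * real n powr (- 1 / ?m) * real (n choose 2)))) *
          exp (2 ^ k * (q * y) * real (n choose 2))"
    using prob_not_ramsey_le[OF assms(1) h] by (elim exE conjE) (rule that)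
  \<comment> \<open>Makes the last factor of the bound equal to exp(\<delta>qN/4), where
    \<open>N\<close> is the number of pairs and \<open>q\<close> the edge probability.\<close>
  define y where "y = \<delta> / (4 * 2 ^ k)"
  have "1 \<le> (2 :: real) ^ k" by simp
  then have "1 \<le> 4 * (2 :: real) ^ k" by linarith
  then have y: "0 < y" "y \<le> 1" using \<delta> by (auto simp: y_def divide_le_eq)
  define b where "b = real k * \<kappa> * ln (1 / y)"
  have b: "0 \<le> b" using y \<kappa> by (simp add: b_def)
  \<comment> \<open>The term \<open>4 * b / \<delta>\<close> bounds the fingerprint factor by
    exp(\<delta>qN/4) as well, leaving exp(-\<delta>qN/2) in total. The summand 1 gives
    \<open>1 \<le> c\<close>.\<close>
  define c where "c = 1 + 4 * b / \<delta>"
  have c: "1 \<le> c" "b \<le> c * \<delta> / 4" using b \<delta> by (auto simp: c_def field_simps)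
  have "(\<lambda>n. measure_pmf.prob (random_graph n (p n))
           {G. ordered_ramsey_graph (naturally_ordered G) H}) \<longlonglongrightarrow> 1"
    if p: "\<forall>n. 0 \<le> p n \<and> p n \<le> 1"
      and ev: "\<forall>\<^sub>F n in sequentially. p n > c * real n powr (- 1 / ?m)" for p
  proof (rule tendsto_sandwich)
    show "\<forall>\<^sub>F n in sequentially. 1 - exp (- (\<delta> / 4 * (real n - 1))) \<le>
        measure_pmf.prob (random_graph n (p n)) {G. ordered_ramsey_graph (naturally_ordered G) H}"
      using ev eventually_ge_at_top[of "max n0 1"]
    proof eventually_elim
      case (elim n)
      let ?N = "real (n choose 2)" and ?p0 = "real n powr (- 1 / ?m)" and ?q = "p n"
      have n: "n0 \<le> n" "1 \<le> n" using elim by auto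
      have q: "0 \<le> ?q" "?q \<le> 1" using p by auto
      have "b * (?p0 * ?N) \<le> c * \<delta> / 4 * (?p0 * ?N)" using c by (intro mult_right_mono) auto
      also have "\<dots> = \<delta> / 4 * (c * ?p0) * ?N" by simp
      also have "\<dots> \<le> \<delta> / 4 * ?q * ?N" using elim \<delta> by (intro mult_right_mono mult_left_mono) auto
      finally have e1: "b * (?p0 * ?N) \<le> \<delta> / 4 * ?q * ?N" .
      have "y powr (- (real k * (\<kappa> * ?p0 * ?N))) = exp (b * (?p0 * ?N))"
        using y by (simp add: powr_def b_def ln_div)
      also have "\<dots> \<le> exp (\<delta> / 4 * ?q * ?N)" using e1 by simp
      finally have e2: "y powr (- (real k * (\<kappa> * ?p0 * ?N))) \<le> exp (\<delta> / 4 * ?q * ?N)" .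
      have e3: "2 ^ k * (?q * y) * ?N = \<delta> / 4 * ?q * ?N" by (simp add: y_def)
      have "measure_pmf.prob (random_graph n ?q) {G. \<not> ordered_ramsey_graph (naturally_ordered G) H}
         \<le> exp (- (?q * (\<delta> * ?N))) * y powr (- (real k * (\<kappa> * ?p0 * ?N))) * exp (2 ^ k * (?q * y) * ?N)"
        using bound n q y by blast
      also have "\<dots> \<le> exp (- (?q * (\<delta> * ?N))) * exp (\<delta> / 4 * ?q * ?N) * exp (\<delta> / 4 * ?q * ?N)"
        unfolding e3 using e2 by (intro mult_right_mono mult_left_mono) auto
      also have "\<dots> = exp (- (\<delta> / 2 * (?q * ?N)))"
        by (simp add: exp_add[symmetric] algebra_simps)
      also have "\<dots> \<le> exp (- (\<delta> / 4 * (real n - 1)))"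
      proof -
        \<comment> \<open>As the 2-density is at least 1, the edge probability is at least 1/n, so
          the expected number of edges grows at least linearly.\<close>
        have "real n powr (- 1) \<le> ?p0" using n h(3) by (intro powr_mono) (auto simp: divide_le_eq)
        also have "\<dots> \<le> c * ?p0" using c by (simp add: mult_le_cancel_right1)
        also have "\<dots> \<le> ?q" using elim by simp
        finally have "1 / real n \<le> ?q" using n by (simp add: powr_minus_divide)
        then have "1 / real n * ?N \<le> ?q * ?N" by (intro mult_right_mono) auto
        moreover have "?N = real n * (real n - 1) / 2"
          using n by (simp add: choose_two real_of_nat_div of_nat_diff)
        then have "1 / real n * ?N = (real n - 1) / 2" using n by simp
        ultimately have "(real n - 1) / 2 \<le> ?q * ?N" by linarith
        then show ?thesis using \<delta> mult_left_mono[of "(real n - 1) / 2" "?q * ?N" "\<delta> / 2"] by simp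
      qed
      finally have "measure_pmf.prob (random_graph n ?q) {G. \<not> ordered_ramsey_graph (naturally_ordered G) H}
          \<le> exp (- (\<delta> / 4 * (real n - 1)))" .
      moreover have "measure_pmf.prob (random_graph n ?q) {G. \<not> ordered_ramsey_graph (naturally_ordered G) H}
          = 1 - measure_pmf.prob (random_graph n ?q) {G. ordered_ramsey_graph (naturally_ordered G) H}"
        using measure_pmf.prob_compl[of "{G. ordered_ramsey_graph (naturally_ordered G) H}" "random_graph n ?q"]
        by (simp add: Compl_eq Compl_eq_Diff_UNIV[symmetric])
      ultimately show ?case by linarith
    qed
    show "(\<lambda>n. 1 - exp (- (\<delta> / 4 * (real n - 1)))) \<longlonglongrightarrow> 1"
      using \<delta> by real_asymp
  qed auto
  then show ?thesis by blast
qed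

end
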